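(* Let $\alpha>\beta>1$, let $f$ be an odd, real-analytic, $2\pi$-periodic function with Fourier expansion $f(t)=\sum_{\nu\ge 1}\hat f_\nu\sin\nu t$, where $\hat f_\nu\in\mathbb{R}$ and $|\hat f_\nu|\le \Phi e^{-\xi\nu}$ for some constants $\Phi,\xi>0$, and for a positive rational number $\rho=p/q$ ($p,q$ relatively prime positive integers) let $$\Delta_1\omega(\rho)=\rho^2\Omega_0^2\left(\max_{0\le\tau_0\le2\pi}\mathfrak{D}_1(\tau_0)-\min_{0\le\tau_0\le 2\pi}\mathfrak{D}_1(\tau_0)\right)$$ be the first-order coefficient (in the driving amplitude $\mu$) of the width of the locking interval of the $p:q$ resonance, where $\Omega_0$ and $\mathfrak{D}_1$ (which depends on $\rho$) are defined in the context. Then there exist positive constants $\xi_1$ and $C$, independent of $\rho$ (that is, of $p$ and $q$), such that for all relatively prime positive integers $p,q$ $$|\Delta_1\omega(p/q)|\le C\,p^2q^{-1}e^{-\xi_1p}e^{-\xi q}.$$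
   Context: Put $h(u)=1-\beta+3\beta u^2$ and $k(u)=u(\alpha-\beta+\beta u^2)$. The perturbed equation under study is $u''+u'h(u)+k(u)+\mu\Psi(u,u',t)=0$ with $\Psi(u,u',t)=u'(3u^2-1)f(\omega t)+u(u^2-1)(f(\omega t)+\omega f'(\omega t))$. For $\alpha>\beta>1$ the unperturbed Liénard equation $u''+u'h(u)+k(u)=0$ has a unique, globally attracting limit cycle encircling the origin; let $T_0$ be its period and $\Omega_0=2\pi/T_0$. Fix $\rho=p/q>0$ with $p,q$ relatively prime. In the rescaled time $\tau=\rho\Omega_0 t$ the unperturbed equation is $\ddot u=G(u,\dot u)$ with $G(u,v)=-\frac{v\,h(u)}{\rho\Omega_0}-\frac{k(u)}{\rho^2\Omega_0^2}$ (dots denote $d/d\tau$). Let $u_0(\tau)$ be the $2\pi\rho$-periodic solution describing the limit cycle, with time origin fixed by $\dot u_0(0)=0$, $u_0(0)=U_0>0$, and let $v_0=\dot u_0$. Let $F(\tau)=\frac{1}{\rho\Omega_0}\int_0^\tau h(u_0(\tau'))\,d\tau'$, $f_0=F(2\pi\rho)/(2\pi\rho)$ and $\tilde F(\tau)=F(\tau)-f_0\tau$, which is $2\pi\rho$-periodic. It is known that $f_0>0$. Let $w_{11}$ be the solution of the linearised equation $\ddot w=\partial_uG(u_0,v_0)\,w+\partial_vG(u_0,v_0)\,\dot w$ with $w_{11}(0)=1$, $\dot w_{11}(0)=0$. It is known that $w_{11}(\tau)=a(\tau)+e^{-f_0\tau}b(\tau)$ with $a,b$ both $2\pi\rho$-periodic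 and $a$ a constant multiple of $\dot u_0$; this determines $b$. Define $$A=\frac{1}{2\pi\rho}\int_0^{2\pi\rho}e^{\tilde F(\tau)}b(\tau)\Big[\dot u_0(\tau)h(u_0(\tau))+\frac{2}{\rho\Omega_0}k(u_0(\tau))\Big]d\tau ,$$ which is known to equal $U_0(\alpha-\beta+\beta U_0^2)/(\rho\Omega_0)$, and $$K_1(\tau)=e^{\tilde F(\tau)}b(\tau)\,\rho\Omega_0\,v_0(\tau)(3u_0^2(\tau)-1),\qquad K_2(\tau)=e^{\tilde F(\tau)}b(\tau)\,u_0(\tau)(u_0^2(\tau)-1).$$ For $\nu\ge1$ and $i=1,2$ set $$B_{i1\nu}=\frac{1}{2\pi p}\int_0^{2\pi p}\frac{K_i(\tau)}{\rho^2\Omega_0^2}\sin\nu\tau\,d\tau,\qquad B_{i2\nu}=\frac{1}{2\pi p}\int_0^{2\pi p}\frac{K_i(\tau)}{\rho^2\Omega_0^2}\cos\nu\tau\,d\tau,$$ $B_{31\nu}=\nu\rho\Omega_0B_{22\nu}$, $B_{32\nu}=-\nu\rho\Omega_0B_{21\nu}$, and $D_{j\nu}=-(B_{1j\nu}+B_{2j\nu}+B_{3j\nu})$ for $j=1,2$. Finally $$\mathfrak{D}_1(\tau_0)=\frac1A\sum_{\nu=1}^\infty\hat f_\nu\big(D_{1\nu}\cos\nu\tau_0+D_{2\nu}\sin\nu\tau_0\big).$$ *)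

theory Defs
  imports "HOL-Analysis.Analysis"
begin

definition real_analytic :: "(real \<Rightarrow> real) \<Rightarrow> bool" where
  "real_analytic f \<longleftrightarrow>
     (\<forall>t0. \<exists>r>0. \<exists>c :: nat \<Rightarrow> real. \<forall>t. \<bar>t - t0\<bar> < r \<longrightarrow> (\<lambda>n. c n * (t - t0) ^ n) sums f t)"

definition solves_ode2 :: "(real \<Rightarrow> real \<Rightarrow> real \<Rightarrow> real) \<Rightarrow> (real \<Rightarrow> real) \<Rightarrow> bool" where
  "solves_ode2 g x \<longleftrightarrow>
     (\<forall>t. (x has_real_derivative deriv x t) (at t) \<and>
          (deriv x has_real_derivative g t (x t) (deriv x t)) (at t))"

definition h_fun :: "real \<Rightarrow> real \<Rightarrow> real" where
  "h_fun \<beta> u = 1 - \<beta> + 3 * \<beta> * u\<^sup>2"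

definition k_fun :: "real \<Rightarrow> real \<Rightarrow> real \<Rightarrow> real" where
  "k_fun \<alpha> \<beta> u = u * (\<alpha> - \<beta> + \<beta> * u\<^sup>2)"

definition lienard_solution :: "real \<Rightarrow> real \<Rightarrow> (real \<Rightarrow> real) \<Rightarrow> bool" where
  "lienard_solution \<alpha> \<beta> x \<longleftrightarrow>
     solves_ode2 (\<lambda>t u v. - (v * h_fun \<beta> u) - k_fun \<alpha> \<beta> u) x"

(* T is the minimal period; minimality excludes equilibria. *)
definition lienard_periodic :: "real \<Rightarrow> real \<Rightarrow> (real \<Rightarrow> real) \<Rightarrow> real \<Rightarrow> bool" where
  "lienard_periodic \<alpha> \<beta> x T \<longleftrightarrow>
     lienard_solution \<alpha> \<beta> x \<and> T > 0 \<and> (\<forall>t. x (t + T) = x t) \<and>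
     (\<forall>S. 0 < S \<and> S < T \<longrightarrow> \<not> (\<forall>t. x (t + S) = x t))"

definition phase_orbit :: "(real \<Rightarrow> real) \<Rightarrow> (real \<times> real) set" where
  "phase_orbit x = range (\<lambda>t. (x t, deriv x t))"

(* A limit cycle is an isolated closed orbit.  Its uniqueness and global attractivity for
   \<alpha> > \<beta> > 1 are theorems about the equation and are not part of the definition. *)
definition limit_cycle :: "real \<Rightarrow> real \<Rightarrow> (real \<Rightarrow> real) \<Rightarrow> real \<Rightarrow> bool" where
  "limit_cycle \<alpha> \<beta> x T \<longleftrightarrow>
     lienard_periodic \<alpha> \<beta> x T \<and>
     (\<exists>e>0. \<forall>y S. lienard_periodic \<alpha> \<beta> y S \<and>
         (\<forall>z \<in> phase_orbit y. infdist z (phase_orbit x) < e) \<longrightarrow> phase_orbit y = phase_orbit x)"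

text \<open>Below, \<open>x\<close> is the limit cycle in the original time \<open>t\<close> and \<open>T\<close> is its period; \<open>\<rho>\<close> is the
  resonance ratio and \<open>\<tau> = \<rho> * \<Omega>0 * t\<close> the rescaled time.\<close>

definition \<Omega>0 :: "real \<Rightarrow> real" where
  "\<Omega>0 T = 2 * pi / T"

definition G_fun :: "real \<Rightarrow> real \<Rightarrow> real \<Rightarrow> real \<Rightarrow> real \<Rightarrow> real \<Rightarrow> real" where
  "G_fun \<alpha> \<beta> T \<rho> u v =
     - (v * h_fun \<beta> u) / (\<rho> * \<Omega>0 T) - k_fun \<alpha> \<beta> u / (\<rho>\<^sup>2 * (\<Omega>0 T)\<^sup>2)"

definition u0 :: "(real \<Rightarrow> real) \<Rightarrow> real \<Rightarrow> real \<Rightarrow> real \<Rightarrow> real" where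
  "u0 x T \<rho> \<tau> = x (\<tau> / (\<rho> * \<Omega>0 T))"

definition v0 :: "(real \<Rightarrow> real) \<Rightarrow> real \<Rightarrow> real \<Rightarrow> real \<Rightarrow> real" where
  "v0 x T \<rho> = deriv (u0 x T \<rho>)"

(* The difference of two integrals is the oriented integral from 0 to \<tau>, also for \<tau> < 0. *)
definition F_fun :: "real \<Rightarrow> (real \<Rightarrow> real) \<Rightarrow> real \<Rightarrow> real \<Rightarrow> real \<Rightarrow> real" where
  "F_fun \<beta> x T \<rho> \<tau> =
     1 / (\<rho> * \<Omega>0 T) *
       (integral {0..\<tau>} (\<lambda>s. h_fun \<beta> (u0 x T \<rho> s)) - integral {\<tau>..0} (\<lambda>s. h_fun \<beta> (u0 x T \<rho> s)))"

definition f0 :: "real \<Rightarrow> (real \<Rightarrow> real) \<Rightarrow> real \<Rightarrow> real \<Rightarrow> real" where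
  "f0 \<beta> x T \<rho> = F_fun \<beta> x T \<rho> (2 * pi * \<rho>) / (2 * pi * \<rho>)"

definition F_tilde :: "real \<Rightarrow> (real \<Rightarrow> real) \<Rightarrow> real \<Rightarrow> real \<Rightarrow> real \<Rightarrow> real" where
  "F_tilde \<beta> x T \<rho> \<tau> = F_fun \<beta> x T \<rho> \<tau> - f0 \<beta> x T \<rho> * \<tau>"

definition w11 :: "real \<Rightarrow> real \<Rightarrow> (real \<Rightarrow> real) \<Rightarrow> real \<Rightarrow> real \<Rightarrow> real \<Rightarrow> real" where
  "w11 \<alpha> \<beta> x T \<rho> = (THE w.
     solves_ode2 (\<lambda>\<tau> y y'.
         deriv (\<lambda>u. G_fun \<alpha> \<beta> T \<rho> u (v0 x T \<rho> \<tau>)) (u0 x T \<rho> \<tau>) * y +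
         deriv (\<lambda>v. G_fun \<alpha> \<beta> T \<rho> (u0 x T \<rho> \<tau>) v) (v0 x T \<rho> \<tau>) * y') w \<and>
     w 0 = 1 \<and> deriv w 0 = 0)"

definition b_fun :: "real \<Rightarrow> real \<Rightarrow> (real \<Rightarrow> real) \<Rightarrow> real \<Rightarrow> real \<Rightarrow> real \<Rightarrow> real" where
  "b_fun \<alpha> \<beta> x T \<rho> = (THE b.
     (\<forall>\<tau>. b (\<tau> + 2 * pi * \<rho>) = b \<tau>) \<and>
     (\<exists>a. (\<forall>\<tau>. a (\<tau> + 2 * pi * \<rho>) = a \<tau>) \<and> (\<exists>c. \<forall>\<tau>. a \<tau> = c * v0 x T \<rho> \<tau>) \<and>
          (\<forall>\<tau>. w11 \<alpha> \<beta> x T \<rho> \<tau> = a \<tau> + exp (- f0 \<beta> x T \<rho> * \<tau>) * b \<tau>)))"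

definition A_const :: "real \<Rightarrow> real \<Rightarrow> (real \<Rightarrow> real) \<Rightarrow> real \<Rightarrow> real \<Rightarrow> real" where
  "A_const \<alpha> \<beta> x T \<rho> =
     1 / (2 * pi * \<rho>) * integral {0..2 * pi * \<rho>} (\<lambda>\<tau>.
       exp (F_tilde \<beta> x T \<rho> \<tau>) * b_fun \<alpha> \<beta> x T \<rho> \<tau> *
       (v0 x T \<rho> \<tau> * h_fun \<beta> (u0 x T \<rho> \<tau>) + 2 / (\<rho> * \<Omega>0 T) * k_fun \<alpha> \<beta> (u0 x T \<rho> \<tau>)))"

definition K1 :: "real \<Rightarrow> real \<Rightarrow> (real \<Rightarrow> real) \<Rightarrow> real \<Rightarrow> real \<Rightarrow> real \<Rightarrow> real" where
  "K1 \<alpha> \<beta> x T \<rho> \<tau> =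
     exp (F_tilde \<beta> x T \<rho> \<tau>) * b_fun \<alpha> \<beta> x T \<rho> \<tau> * \<rho> * \<Omega>0 T *
     v0 x T \<rho> \<tau> * (3 * (u0 x T \<rho> \<tau>)\<^sup>2 - 1)"

definition K2 :: "real \<Rightarrow> real \<Rightarrow> (real \<Rightarrow> real) \<Rightarrow> real \<Rightarrow> real \<Rightarrow> real \<Rightarrow> real" where
  "K2 \<alpha> \<beta> x T \<rho> \<tau> =
     exp (F_tilde \<beta> x T \<rho> \<tau>) * b_fun \<alpha> \<beta> x T \<rho> \<tau> * u0 x T \<rho> \<tau> * ((u0 x T \<rho> \<tau>)\<^sup>2 - 1)"

(* B_coeff g K p q \<nu> with g = sin, cos gives B_{i1\<nu>}, B_{i2\<nu>} for K = K1, K2 at \<rho> = p/q. *)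
definition B_coeff ::
  "(real \<Rightarrow> real) \<Rightarrow> (real \<Rightarrow> real \<Rightarrow> real) \<Rightarrow> real \<Rightarrow> nat \<Rightarrow> nat \<Rightarrow> nat \<Rightarrow> real" where
  "B_coeff g K T p q \<nu> = (let \<rho> = real p / real q in
     1 / (2 * pi * real p) *
       integral {0..2 * pi * real p} (\<lambda>\<tau>. K \<rho> \<tau> / (\<rho>\<^sup>2 * (\<Omega>0 T)\<^sup>2) * g (real \<nu> * \<tau>)))"

definition B11 :: "real \<Rightarrow> real \<Rightarrow> (real \<Rightarrow> real) \<Rightarrow> real \<Rightarrow> nat \<Rightarrow> nat \<Rightarrow> nat \<Rightarrow> real" where
  "B11 \<alpha> \<beta> x T = B_coeff sin (K1 \<alpha> \<beta> x T) T"

definition B12 :: "real \<Rightarrow> real \<Rightarrow> (real \<Rightarrow> real) \<Rightarrow> real \<Rightarrow> nat \<Rightarrow> nat \<Rightarrow> nat \<Rightarrow> real" where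
  "B12 \<alpha> \<beta> x T = B_coeff cos (K1 \<alpha> \<beta> x T) T"

definition B21 :: "real \<Rightarrow> real \<Rightarrow> (real \<Rightarrow> real) \<Rightarrow> real \<Rightarrow> nat \<Rightarrow> nat \<Rightarrow> nat \<Rightarrow> real" where
  "B21 \<alpha> \<beta> x T = B_coeff sin (K2 \<alpha> \<beta> x T) T"

definition B22 :: "real \<Rightarrow> real \<Rightarrow> (real \<Rightarrow> real) \<Rightarrow> real \<Rightarrow> nat \<Rightarrow> nat \<Rightarrow> nat \<Rightarrow> real" where
  "B22 \<alpha> \<beta> x T = B_coeff cos (K2 \<alpha> \<beta> x T) T"

definition B31 :: "real \<Rightarrow> real \<Rightarrow> (real \<Rightarrow> real) \<Rightarrow> real \<Rightarrow> nat \<Rightarrow> nat \<Rightarrow> nat \<Rightarrow> real" where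
  "B31 \<alpha> \<beta> x T p q \<nu> = real \<nu> * (real p / real q) * \<Omega>0 T * B22 \<alpha> \<beta> x T p q \<nu>"

definition B32 :: "real \<Rightarrow> real \<Rightarrow> (real \<Rightarrow> real) \<Rightarrow> real \<Rightarrow> nat \<Rightarrow> nat \<Rightarrow> nat \<Rightarrow> real" where
  "B32 \<alpha> \<beta> x T p q \<nu> = - real \<nu> * (real p / real q) * \<Omega>0 T * B21 \<alpha> \<beta> x T p q \<nu>"

definition D1 :: "real \<Rightarrow> real \<Rightarrow> (real \<Rightarrow> real) \<Rightarrow> real \<Rightarrow> nat \<Rightarrow> nat \<Rightarrow> nat \<Rightarrow> real" where
  "D1 \<alpha> \<beta> x T p q \<nu> =
     - (B11 \<alpha> \<beta> x T p q \<nu> + B21 \<alpha> \<beta> x T p q \<nu> + B31 \<alpha> \<beta> x T p q \<nu>)"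

definition D2 :: "real \<Rightarrow> real \<Rightarrow> (real \<Rightarrow> real) \<Rightarrow> real \<Rightarrow> nat \<Rightarrow> nat \<Rightarrow> nat \<Rightarrow> real" where
  "D2 \<alpha> \<beta> x T p q \<nu> =
     - (B12 \<alpha> \<beta> x T p q \<nu> + B22 \<alpha> \<beta> x T p q \<nu> + B32 \<alpha> \<beta> x T p q \<nu>)"

(* fhat \<nu> is the sine coefficient for \<nu> \<ge> 1; fhat 0 is never used. *)
definition frakD1 ::
  "real \<Rightarrow> real \<Rightarrow> (real \<Rightarrow> real) \<Rightarrow> real \<Rightarrow> (nat \<Rightarrow> real) \<Rightarrow> nat \<Rightarrow> nat \<Rightarrow> real \<Rightarrow> real" where
  "frakD1 \<alpha> \<beta> x T fhat p q \<tau>0 =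
     1 / A_const \<alpha> \<beta> x T (real p / real q) *
       (\<Sum>n. fhat (Suc n) * (D1 \<alpha> \<beta> x T p q (Suc n) * cos (real (Suc n) * \<tau>0) +
                             D2 \<alpha> \<beta> x T p q (Suc n) * sin (real (Suc n) * \<tau>0)))"

(* frakD1 is continuous in \<tau>0, so SUP and INF over [0, 2 pi] are its maximum and minimum. *)
definition \<Delta>1\<omega> ::
  "real \<Rightarrow> real \<Rightarrow> (real \<Rightarrow> real) \<Rightarrow> real \<Rightarrow> (nat \<Rightarrow> real) \<Rightarrow> nat \<Rightarrow> nat \<Rightarrow> real" where
  "\<Delta>1\<omega> \<alpha> \<beta> x T fhat p q =
     (real p / real q)\<^sup>2 * (\<Omega>0 T)\<^sup>2 *
       ((SUP \<tau>0\<in>{0..2 * pi}. frakD1 \<alpha> \<beta> x T fhat p q \<tau>0) -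
        (INF \<tau>0\<in>{0..2 * pi}. frakD1 \<alpha> \<beta> x T fhat p q \<tau>0))"

end

theory Submission
  imports Defs
begin

text \<open>In the original time every kernel is a fixed \<open>T0\<close>-periodic function, evaluated at
  \<open>\<tau> / (\<rho> \<Omega>0)\<close>. At \<open>\<rho> = p / q\<close> its frequencies in \<open>\<tau>\<close> are the multiples of \<open>q / p\<close>, so only
  \<open>\<nu> = q n\<close> resonates, with the \<open>p n\<close>-th Fourier coefficient of the kernel. The kernels are
  real-analytic uniformly in time, because \<open>x\<close>, \<open>x'\<close> and the periodic solution \<open>e\<^bsup>F\<^esup> b\<close> of the adjoint
  linearised equation solve a quadratic system, so these coefficients are \<open>O(e\<^bsup>- \<xi>1 p n\<^esup>)\<close>; the
  factor \<open>e\<^bsup>- \<xi> q n\<^esup>\<close> comes from \<open>fhat\<close>. The function \<open>b\<close> is determined only if the cycle is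
  hyperbolic, which the hypotheses do not state; it is deduced from a Dulac-type argument. If
  \<open>A = 0\<close>, the bound is trivial, as \<open>1 / 0 = 0\<close>.\<close>

section \<open>Functions with geometrically bounded Taylor coefficients\<close>

text \<open>\<open>c n\<close> is the n-th derivative divided by n!, whence the factor
  \<open>Suc n\<close>. The bound, uniform in t, is a real-variable form of a holomorphic extension
  to the strip of half-width 1 / \<open>R\<close>.\<close>

definition taylor_bounded :: "(real \<Rightarrow> 'a::real_normed_vector) \<Rightarrow> real \<Rightarrow> real \<Rightarrow> bool" where
  "taylor_bounded f M R \<longleftrightarrow> (\<exists>c :: nat \<Rightarrow> real \<Rightarrow> 'a. c 0 = f \<and>
     (\<forall>n t. (c n has_vector_derivative real (Suc n) *\<^sub>R c (Suc n) t) (at t)) \<and>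
     (\<forall>n t. norm (c n t) \<le> M * R ^ n))"

text \<open>Linear maps act on the Taylor coefficients one by one. Later this extracts the
  components of a vector-valued solution, with \<open>R\<close> unchanged.\<close>

lemma taylor_bounded_bounded_linear:
  assumes "bounded_linear L" "taylor_bounded f M R" "R > 0"
  shows "\<exists>M'. taylor_bounded (\<lambda>t. L (f t)) M' R"
proof -
  interpret bounded_linear L by fact
  obtain c where c: "c 0 = f"
    "\<And>n t. (c n has_vector_derivative real (Suc n) *\<^sub>R c (Suc n) t) (at t)"
    "\<And>n t. norm (c n t) \<le> M * R ^ n"
    using assms(2) unfolding taylor_bounded_def by auto
  obtain K where K: "\<And>x. norm (L x) \<le> norm x * K" "K > 0"
    using pos_bounded by auto
  have "taylor_bounded (\<lambda>t. L (f t)) (M * K) R"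
    unfolding taylor_bounded_def
  proof (intro exI[of _ "\<lambda>n t. L (c n t)"] conjI allI)
    fix n t
    show "((\<lambda>t. L (c n t)) has_vector_derivative real (Suc n) *\<^sub>R L (c (Suc n) t)) (at t)"
      using has_vector_derivative[OF c(2)] by (simp only: scaleR)
    have "norm (L (c n t)) \<le> norm (c n t) * K" by (rule K)
    also have "\<dots> \<le> M * R ^ n * K" using c(3) K(2) by (intro mult_right_mono) auto
    finally show "norm (L (c n t)) \<le> M * K * R ^ n" by (simp add: ac_simps)
  qed (simp add: c)
  then show ?thesis ..
qed

lemma taylor_bounded_mono:
  assumes "taylor_bounded f M R" "M \<le> M'" "0 \<le> R" "R \<le> R'"
  shows "taylor_bounded f M' R'"
proof -
  obtain c where c: "c 0 = f"
    "\<And>n t. (c n has_vector_derivative real (Suc n) *\<^sub>R c (Suc n) t) (at t)"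
    "\<And>n t. norm (c n t) \<le> M * R ^ n"
    using assms(1) unfolding taylor_bounded_def by auto
  have M: "0 \<le> M" using order_trans[OF norm_ge_zero c(3)[of 0 0]] by simp
  have "norm (c n t) \<le> M' * R' ^ n" for n t
    by (rule order_trans[OF c(3)])
      (use assms M in \<open>intro mult_mono power_mono; simp\<close>)
  with c show ?thesis unfolding taylor_bounded_def by blast
qed

text \<open>Leibniz's rule for derivatives divided by n!: the k-th summand gets weight k from the
  first factor and \<open>Suc n - k\<close> from the second. The derivative rules are assumed only
  for k up to n, so that an induction on n can supply them.\<close>

lemma convolution_has_vector_derivative:
  fixes c :: "nat \<Rightarrow> real \<Rightarrow> 'a::real_normed_vector" and d :: "nat \<Rightarrow> real \<Rightarrow> 'b::real_normed_vector"
  assumes "bounded_bilinear Q"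
    and c: "\<And>k. k \<le> n \<Longrightarrow> (c k has_vector_derivative real (Suc k) *\<^sub>R c (Suc k) t) (at t)"
    and d: "\<And>k. k \<le> n \<Longrightarrow> (d k has_vector_derivative real (Suc k) *\<^sub>R d (Suc k) t) (at t)"
  shows "((\<lambda>t. \<Sum>k\<le>n. Q (c k t) (d (n - k) t)) has_vector_derivative
           real (Suc n) *\<^sub>R (\<Sum>k\<le>Suc n. Q (c k t) (d (Suc n - k) t))) (at t)"
proof -
  interpret bounded_bilinear Q by fact
  let ?q = "\<lambda>k. Q (c k t) (d (Suc n - k) t)"
  have "((\<lambda>t. \<Sum>k\<le>n. Q (c k t) (d (n - k) t)) has_vector_derivative
      (\<Sum>k\<le>n. Q (c k t) (real (Suc (n - k)) *\<^sub>R d (Suc (n - k)) t) +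
         Q (real (Suc k) *\<^sub>R c (Suc k) t) (d (n - k) t))) (at t)"
    by (intro has_vector_derivative_sum has_vector_derivative c d) auto
  also have "(\<Sum>k\<le>n. Q (c k t) (real (Suc (n - k)) *\<^sub>R d (Suc (n - k)) t) +
         Q (real (Suc k) *\<^sub>R c (Suc k) t) (d (n - k) t)) =
      (\<Sum>k\<le>n. real (Suc n - k) *\<^sub>R ?q k) + (\<Sum>k\<le>n. real (Suc k) *\<^sub>R ?q (Suc k))"
    by (simp add: sum.distrib scaleR_left scaleR_right Suc_diff_le flip: of_nat_Suc)
  \<comment> \<open>The summand added here, k = \<open>Suc n\<close>, has weight 0; in the index
    shift that follows the one with k = 0 does.\<close>
  also have "(\<Sum>k\<le>n. real (Suc n - k) *\<^sub>R ?q k) = (\<Sum>k\<le>Suc n. real (Suc n - k) *\<^sub>R ?q k)"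
    by simp
  also have "(\<Sum>k\<le>n. real (Suc k) *\<^sub>R ?q (Suc k)) = (\<Sum>k\<le>Suc n. real k *\<^sub>R ?q k)"
    by (subst sum.atMost_Suc_shift) simp
  also have "(\<Sum>k\<le>Suc n. real (Suc n - k) *\<^sub>R ?q k) + (\<Sum>k\<le>Suc n. real k *\<^sub>R ?q k) =
      (\<Sum>k\<le>Suc n. real (Suc n) *\<^sub>R ?q k)"
    unfolding sum.distrib[symmetric] scaleR_add_left[symmetric]
    by (intro sum.cong refl arg_cong2[where f = scaleR]) (simp del: of_nat_Suc flip: of_nat_add)
  finally show ?thesis by (simp only: scaleR_sum_right)
qed

text \<open>The Cauchy product has n + 1 summands, each at most M M' R^n; doubling \<open>R\<close>
  absorbs n + 1, which is at most 2^n.\<close>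

lemma taylor_bounded_mult:
  fixes f g :: "real \<Rightarrow> real"
  assumes f: "taylor_bounded f M R" and g: "taylor_bounded g M' R" and R: "R > 0"
  shows "taylor_bounded (\<lambda>t. f t * g t) (M * M') (2 * R)"
proof -
  obtain c where c: "c 0 = f"
    "\<And>n t. (c n has_vector_derivative real (Suc n) *\<^sub>R c (Suc n) t) (at t)"
    "\<And>n t. norm (c n t) \<le> M * R ^ n"
    using f unfolding taylor_bounded_def by auto
  obtain d where d: "d 0 = g"
    "\<And>n t. (d n has_vector_derivative real (Suc n) *\<^sub>R d (Suc n) t) (at t)"
    "\<And>n t. norm (d n t) \<le> M' * R ^ n"
    using g unfolding taylor_bounded_def by auto
  have M: "0 \<le> M" "0 \<le> M'"
    using order_trans[OF norm_ge_zero c(3)[of 0 0]] order_trans[OF norm_ge_zero d(3)[of 0 0]]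
    by simp_all
  show ?thesis unfolding taylor_bounded_def
  proof (intro exI[of _ "\<lambda>n t. \<Sum>k\<le>n. c k t * d (n - k) t"] conjI allI)
    show "((\<lambda>t. \<Sum>k\<le>n. c k t * d (n - k) t) has_vector_derivative
           real (Suc n) *\<^sub>R (\<Sum>k\<le>Suc n. c k t * d (Suc n - k) t)) (at t)" for n t
      by (intro convolution_has_vector_derivative bounded_bilinear_mult c d)
    show "norm (\<Sum>k\<le>n. c k t * d (n - k) t) \<le> M * M' * (2 * R) ^ n" for n t
    proof -
      have "norm (c k t * d (n - k) t) \<le> M * M' * R ^ n" if "k \<le> n" for k
      proof -
        have "norm (c k t * d (n - k) t) \<le> (M * R ^ k) * (M' * R ^ (n - k))"
          unfolding norm_mult using c(3) d(3) M R by (intro mult_mono) auto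
        also have "\<dots> = M * M' * R ^ n"
          using that by (simp add: power_add[symmetric])
        finally show ?thesis .
      qed
      then have "norm (\<Sum>k\<le>n. c k t * d (n - k) t) \<le> real (Suc n) * (M * M' * R ^ n)"
        using sum_norm_bound[of "{..n}" "\<lambda>k. c k t * d (n - k) t" "M * M' * R ^ n"] by simp
      also have "\<dots> \<le> 2 ^ n * (M * M' * R ^ n)"
        using M R of_nat_mono[OF Suc_leI[OF less_exp[of n]], where 'a = real]
        by (intro mult_right_mono) (simp_all del: of_nat_Suc)
      finally show ?thesis by (simp add: power_mult_distrib ac_simps)
    qed
  qed (simp add: c d)
qed

text \<open>Each derivative contributes a factor 1 / \<open>s\<close>. This is how the time scale
  \<rho> \<Omega>0 enters the decay rate of the Fourier coefficients.\<close>

lemma taylor_bounded_rescale: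
  assumes "taylor_bounded f M R" "s > 0"
  shows "taylor_bounded (\<lambda>t. f (t / s)) M (R / s)"
proof -
  obtain c where c: "c 0 = f"
    "\<And>n t. (c n has_vector_derivative real (Suc n) *\<^sub>R c (Suc n) t) (at t)"
    "\<And>n t. norm (c n t) \<le> M * R ^ n"
    using assms unfolding taylor_bounded_def by auto
  show ?thesis unfolding taylor_bounded_def
  proof (intro exI[of _ "\<lambda>n t. (1 / s ^ n) *\<^sub>R c n (t / s)"] conjI allI)
    fix n t
    have "((c n \<circ> (\<lambda>t. t / s)) has_vector_derivative
        (1 / s) *\<^sub>R (real (Suc n) *\<^sub>R c (Suc n) (t / s))) (at t)"
      by (intro vector_diff_chain_at c)
        (use assms(2) in \<open>auto intro!: derivative_eq_intros
           simp flip: has_real_derivative_iff_has_vector_derivative\<close>)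
    from has_vector_derivative_scaleR[OF DERIV_const[of "1 / s ^ n"] this]
    show "((\<lambda>t. (1 / s ^ n) *\<^sub>R c n (t / s)) has_vector_derivative
        real (Suc n) *\<^sub>R ((1 / s ^ Suc n) *\<^sub>R c (Suc n) (t / s))) (at t)"
      by (simp add: ac_simps)
    show "norm ((1 / s ^ n) *\<^sub>R c n (t / s)) \<le> M * (R / s) ^ n"
      using c(3)[of n "t / s"] assms(2) by (simp add: power_divide divide_right_mono)
  qed (simp add: c)
qed

text \<open>The Taylor coefficients of a solution of a quadratic system satisfy
  \<open>(n + 1) c\<^sub>n\<^sub>+\<^sub>1 = \<Sum>\<^sub>k Q c\<^sub>k c\<^sub>n\<^sub>-\<^sub>k\<close>; the \<open>n + 1\<close> summands cancel the factor on the left,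
  so a geometric bound propagates.\<close>

lemma taylor_bounded_quadratic_ode:
  fixes y :: "real \<Rightarrow> 'a::real_normed_vector"
  assumes Q: "bounded_bilinear Q"
    and ode: "\<And>t. (y has_vector_derivative Q (y t) (y t)) (at t)"
    and bound: "\<And>t. norm (y t) \<le> M" and M: "M > 0"
  shows "\<exists>R>0. taylor_bounded y M R"
proof -
  interpret bounded_bilinear Q by fact
  obtain K where K: "\<And>a b. norm (Q a b) \<le> norm a * norm b * K" "K > 0"
    using pos_bounded by auto
  \<comment> \<open>The recursion refers to all earlier coefficients, so it builds tables:
    \<open>C n t\<close> is correct at the indices up to n, and \<open>c\<close> reads off the
    diagonal.\<close>
  define C :: "nat \<Rightarrow> real \<Rightarrow> nat \<Rightarrow> 'a" where "C = rec_nat (\<lambda>t k. y t)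
     (\<lambda>n r t k. if k \<le> n then r t k
        else (1 / real (Suc n)) *\<^sub>R (\<Sum>j\<le>n. Q (r t j) (r t (n - j))))"
  define c where "c n t = C n t n" for n t
  have C0: "C 0 t k = y t" and CS: "C (Suc n) t k = (if k \<le> n then C n t k
        else (1 / real (Suc n)) *\<^sub>R (\<Sum>j\<le>n. Q (C n t j) (C n t (n - j))))" for n t k
    by (simp_all add: C_def)
  have C_stable: "k \<le> n \<Longrightarrow> C n t k = C k t k" for n t k
    by (induction n) (auto simp: C0 CS le_Suc_eq)
  have c0: "c 0 = y" by (simp add: c_def C0 fun_eq_iff)
  have cS: "c (Suc n) t = (1 / real (Suc n)) *\<^sub>R (\<Sum>j\<le>n. Q (c j t) (c (n - j) t))" for n t
  proof -
    have "(\<Sum>j\<le>n. Q (C n t j) (C n t (n - j))) = (\<Sum>j\<le>n. Q (c j t) (c (n - j) t))"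
      by (intro sum.cong refl arg_cong2[where f = Q]) (auto simp: c_def intro: C_stable)
    then show ?thesis by (simp add: c_def CS)
  qed
  have der: "(c n has_vector_derivative real (Suc n) *\<^sub>R c (Suc n) t) (at t)" for n t
  proof (induction n rule: less_induct)
    case (less n)
    show ?case
    proof (cases n)
      case 0
      then show ?thesis using ode[of t] by (simp add: c0 cS)
    next
      case (Suc m)
      have "((\<lambda>t. \<Sum>j\<le>m. Q (c j t) (c (m - j) t)) has_vector_derivative
           real (Suc m) *\<^sub>R (\<Sum>j\<le>Suc m. Q (c j t) (c (Suc m - j) t))) (at t)"
        using less Suc by (intro convolution_has_vector_derivative Q) auto
      from has_vector_derivative_scaleR[OF DERIV_const[of "1 / real (Suc m)"] this]
      have "(c (Suc m) has_vector_derivative (\<Sum>j\<le>Suc m. Q (c j t) (c (Suc m - j) t))) (at t)"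
        unfolding cS[abs_def] by (simp del: of_nat_Suc sum.atMost_Suc)
      also have "(\<Sum>j\<le>Suc m. Q (c j t) (c (Suc m - j) t)) = real (Suc n) *\<^sub>R c (Suc n) t"
        unfolding cS Suc by (simp del: of_nat_Suc sum.atMost_Suc)
      finally show ?thesis unfolding Suc .
    qed
  qed
  \<comment> \<open>Compared with M R^m, a summand of the recursion carries one more
    \<open>M\<close> from the second argument and a \<open>K\<close> from \<open>Q\<close>.\<close>
  define R where "R = K * M"
  have bd: "norm (c n t) \<le> M * R ^ n" for n t
  proof (induction n rule: less_induct)
    case (less n)
    show ?case
    proof (cases n)
      case 0
      then show ?thesis using bound by (simp add: c0)
    next
      case (Suc m)
      have "norm (Q (c j t) (c (m - j) t)) \<le> M * R ^ n" if "j \<le> m" for j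
      proof -
        have "norm (Q (c j t) (c (m - j) t)) \<le> norm (c j t) * norm (c (m - j) t) * K" by (rule K)
        also have "\<dots> \<le> (M * R ^ j) * (M * R ^ (m - j)) * K"
          using less that Suc M K(2) by (intro mult_right_mono mult_mono) (auto simp: R_def)
        also have "\<dots> = M * R ^ n"
          using that by (simp add: Suc R_def power_add[symmetric])
        finally show ?thesis .
      qed
      then have "norm (\<Sum>j\<le>m. Q (c j t) (c (m - j) t)) \<le> real (Suc m) * (M * R ^ n)"
        using sum_norm_bound[of "{..m}" "\<lambda>j. Q (c j t) (c (m - j) t)" "M * R ^ n"] by simp
      then show ?thesis
        unfolding Suc cS by (simp add: divide_simps mult.commute del: of_nat_Suc)
    qed
  qed
  show ?thesis
    using c0 der bd K(2) M by (intro exI[of _ R]) (auto simp: taylor_bounded_def R_def)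
qed

section \<open>Fourier integrals\<close>

text \<open>Integrating by parts \<open>n\<close> times gives \<open>\<bar>J\<bar> \<le> M P n! (R / w)\<^sup>n\<close> for every \<open>n\<close>. Dividing by
  \<open>n! (2 R / w)\<^sup>n\<close> and summing over \<open>n\<close> yields the exponential bound.\<close>

lemma fourier_integral_bound:
  fixes K :: "real \<Rightarrow> real"
  assumes K: "taylor_bounded K M R" "R > 0" and per: "\<And>t. K (t + P) = K t" and P: "P > 0"
    and w: "w > 0" "cis (w * P) = 1"
  shows "norm (integral {0..P} (\<lambda>t. K t *\<^sub>R cis (w * t))) \<le> 2 * M * P * exp (- w / (2 * R))"
proof -
  obtain c where c: "c 0 = K"
    "\<And>n t. (c n has_vector_derivative real (Suc n) *\<^sub>R c (Suc n) t) (at t)"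
    "\<And>n t. norm (c n t) \<le> M * R ^ n"
    using K unfolding taylor_bounded_def by auto
  have c_per: "c n (t + P) = c n t" for n t
  proof (induction n arbitrary: t)
    case 0
    show ?case by (simp add: c per)
  next
    case (Suc n)
    have "(c n \<circ> (\<lambda>t. t + P) has_vector_derivative
        1 *\<^sub>R (real (Suc n) *\<^sub>R c (Suc n) (t + P))) (at t)"
      by (intro vector_diff_chain_at c)
        (auto intro!: derivative_eq_intros simp flip: has_real_derivative_iff_has_vector_derivative)
    moreover have "c n \<circ> (\<lambda>t. t + P) = c n" using Suc by (simp add: fun_eq_iff)
    ultimately have "real (Suc n) *\<^sub>R c (Suc n) t = 1 *\<^sub>R (real (Suc n) *\<^sub>R c (Suc n) (t + P))"
      by (metis vector_derivative_unique_at c(2))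
    then show ?case by (simp del: of_nat_Suc)
  qed
  define J where "J n = integral {0..P} (\<lambda>t. c n t *\<^sub>R cis (w * t))" for n
  have cont: "continuous_on S (c n)" for n S
    by (meson c(2) continuous_at_imp_continuous_on has_vector_derivative_continuous)
  have intg: "(\<lambda>t. c n t *\<^sub>R cis (w * t)) integrable_on {0..P}" for n
    by (intro integrable_continuous_real continuous_intros cont)
  \<comment> \<open>Integration by parts: the boundary terms cancel because \<open>c n\<close> and
    \<open>cis (w * t)\<close> both have period \<open>P\<close>.\<close>
  have J_step: "w * norm (J n) = real (Suc n) * norm (J (Suc n))" for n
  proof -
    have "((\<lambda>t. c n t *\<^sub>R cis (w * t)) has_vector_derivative
        w *\<^sub>R (\<i> * (c n t *\<^sub>R cis (w * t))) + real (Suc n) *\<^sub>R (c (Suc n) t *\<^sub>R cis (w * t))) (at t)" for t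
    proof -
      have "(c n has_real_derivative real (Suc n) * c (Suc n) t) (at t)"
        using c(2)[of n t] by (simp add: has_real_derivative_iff_has_vector_derivative)
      moreover have "((\<lambda>t. cis (w * t)) has_vector_derivative w *\<^sub>R (\<i> * cis (w * t))) (at t)"
        unfolding has_vector_derivative_def
        by (auto intro!: derivative_eq_intros simp: mult.commute)
      ultimately show ?thesis
        by (rule has_vector_derivative_eq_rhs[OF has_vector_derivative_scaleR])
          (simp add: scaleR_conv_of_real algebra_simps)
    qed
    then have ftc: "((\<lambda>t. w *\<^sub>R (\<i> * (c n t *\<^sub>R cis (w * t))) + real (Suc n) *\<^sub>R (c (Suc n) t *\<^sub>R cis (w * t)))
        has_integral c n P *\<^sub>R cis (w * P) - c n 0 *\<^sub>R cis (w * 0)) {0..P}"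
      using P by (intro fundamental_theorem_of_calculus) (auto intro: has_vector_derivative_at_within)
    have split: "((\<lambda>t. w *\<^sub>R (\<i> * (c n t *\<^sub>R cis (w * t))) + real (Suc n) *\<^sub>R (c (Suc n) t *\<^sub>R cis (w * t)))
        has_integral w *\<^sub>R (\<i> * J n) + real (Suc n) *\<^sub>R J (Suc n)) {0..P}"
      unfolding J_def
      by (intro has_integral_add has_integral_cmul has_integral_mult_right integrable_integral intg)
    have "c n P *\<^sub>R cis (w * P) - c n 0 *\<^sub>R cis (w * 0) = 0"
      using c_per[of n 0] w by simp
    then have "w *\<^sub>R (\<i> * J n) = - (real (Suc n) *\<^sub>R J (Suc n))"
      using has_integral_unique[OF split ftc] by (simp only: eq_neg_iff_add_eq_0)
    then have "norm (w *\<^sub>R (\<i> * J n)) = norm (real (Suc n) *\<^sub>R J (Suc n))" by simp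
    then show ?thesis using w by (simp add: norm_mult del: of_nat_Suc)
  qed
  have J_fact: "w ^ n * norm (J 0) = fact n * norm (J n)" for n
  proof (induction n)
    case (Suc n)
    have "w ^ Suc n * norm (J 0) = fact n * (w * norm (J n))" using Suc by simp
    then show ?case unfolding J_step by simp
  qed simp
  have J_bound: "norm (J n) \<le> M * R ^ n * P" for n
  proof -
    have "norm (J n) \<le> (M * R ^ n) * (P - 0)"
      unfolding J_def
      by (rule integral_bound) (use P c(3) in \<open>auto intro!: continuous_intros cont\<close>)
    then show ?thesis by simp
  qed
  have summand: "norm (J 0) * (w / (2 * R)) ^ n / fact n \<le> M * P * (1 / 2) ^ n" for n
  proof -
    have "norm (J 0) * (w / (2 * R)) ^ n / fact n = norm (J n) / (2 * R) ^ n"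
      using J_fact[of n] by (simp add: power_divide field_simps)
    also have "\<dots> \<le> (M * R ^ n * P) / (2 * R) ^ n"
      using J_bound K(2) by (intro divide_right_mono) auto
    also have "\<dots> = M * P * (1 / 2) ^ n"
      using K(2) by (simp add: power_divide power_mult_distrib)
    finally show ?thesis .
  qed
  have scaleR_eq: "a * (b /\<^sub>R d) = a * b / d" for a b d :: real
    by (simp add: divide_inverse)
  have "(\<lambda>n. norm (J 0) * ((w / (2 * R)) ^ n /\<^sub>R fact n)) sums (norm (J 0) * exp (w / (2 * R)))"
    by (intro sums_mult exp_converges)
  then have "(\<lambda>n. norm (J 0) * (w / (2 * R)) ^ n / fact n) sums (norm (J 0) * exp (w / (2 * R)))"
    by (simp only: scaleR_eq)
  moreover have "(\<lambda>n. M * P * (1 / 2) ^ n) sums (M * P * (1 / (1 - 1 / 2)))"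
    by (intro sums_mult geometric_sums) simp
  ultimately have "norm (J 0) * exp (w / (2 * R)) \<le> M * P * (1 / (1 - 1 / 2))"
    by (rule sums_le[OF summand])
  then have "norm (J 0) \<le> 2 * M * P * exp (- w / (2 * R))"
    by (simp add: exp_minus divide_simps ac_simps)
  then show ?thesis by (simp add: J_def c)
qed

text \<open>The shifted interval from L to P + L is cut at P, and its last piece is moved back by
  one period.\<close>

lemma integral_shift_periodic:
  fixes g :: "real \<Rightarrow> 'a::euclidean_space"
  assumes cont: "continuous_on UNIV g" and per: "\<And>t. g (t + P) = g t" and L: "0 \<le> L" "L \<le> P"
  shows "integral {0..P} (\<lambda>t. g (t + L)) = integral {0..P} g"
proof -
  have int: "g integrable_on {a..b}" for a b
    by (rule integrable_continuous_real) (rule continuous_on_subset[OF cont], simp)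
  have shift: "integral {a..b} (\<lambda>t. g (t + c)) = integral {a + c..b + c} g" for a b c
    using integral_shift[of a c b g] continuous_on_subset[OF cont, of "{a + c..b + c}"]
    by (simp add: o_def)
  have "integral {0..P} (\<lambda>t. g (t + L)) = integral {L..P} g + integral {P..P + L} g"
    using L by (simp add: shift Henstock_Kurzweil_Integration.integral_combine int)
  also have "integral {P..P + L} g = integral {0..L} g"
    using shift[of 0 L P] by (simp add: per add.commute)
  finally show ?thesis
    using Henstock_Kurzweil_Integration.integral_combine[OF L int] by (simp add: add.commute)
qed

text \<open>A shift by \<open>L\<close> fixes \<open>K\<close> and turns the integral into
  \<open>cis (w * L)\<close> times itself. This removes the nonresonant frequencies.\<close>

lemma fourier_integral_eq_0:
  fixes K :: "real \<Rightarrow> real"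
  assumes cont: "continuous_on UNIV K" and per: "\<And>t. K (t + L) = K t"
    and perP: "\<And>t. K (t + P) = K t" and L: "0 \<le> L" "L \<le> P"
    and w: "cis (w * P) = 1" "cis (w * L) \<noteq> 1"
  shows "integral {0..P} (\<lambda>t. K t *\<^sub>R cis (w * t)) = 0"
proof -
  let ?g = "\<lambda>t. K t *\<^sub>R cis (w * t)"
  have "integral {0..P} ?g = integral {0..P} (\<lambda>t. ?g (t + L))"
    using w by (intro integral_shift_periodic[symmetric] L continuous_intros cont)
      (simp add: perP distrib_left flip: cis_mult)
  also have "\<dots> = integral {0..P} (\<lambda>t. cis (w * L) * ?g t)"
    by (intro integral_cong) (simp add: per distrib_left flip: cis_mult)
  also have "\<dots> = cis (w * L) * integral {0..P} ?g"
    by (rule integral_mult_right)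
  finally show ?thesis using w by simp
qed

text \<open>As \<open>K\<close> is real, these are the real and imaginary parts of one complex
  integral, so a single estimate serves both.\<close>

lemma integral_mult_cos_sin_le:
  fixes K :: "real \<Rightarrow> real"
  assumes "continuous_on UNIV K"
  shows "\<bar>integral {a..b} (\<lambda>t. K t * cos (w * t))\<bar> \<le> norm (integral {a..b} (\<lambda>t. K t *\<^sub>R cis (w * t)))"
    and "\<bar>integral {a..b} (\<lambda>t. K t * sin (w * t))\<bar> \<le> norm (integral {a..b} (\<lambda>t. K t *\<^sub>R cis (w * t)))"
proof -
  have int: "((\<lambda>t. K t *\<^sub>R cis (w * t)) has_integral integral {a..b} (\<lambda>t. K t *\<^sub>R cis (w * t))) {a..b}"
    by (intro integrable_integral integrable_continuous_real continuous_intros)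
      (rule continuous_on_subset[OF assms], simp)
  have "((\<lambda>t. K t * cos (w * t)) has_integral Re (integral {a..b} (\<lambda>t. K t *\<^sub>R cis (w * t)))) {a..b}"
    using has_integral_linear[OF int bounded_linear_Re] by (simp add: o_def)
  then show "\<bar>integral {a..b} (\<lambda>t. K t * cos (w * t))\<bar> \<le> norm (integral {a..b} (\<lambda>t. K t *\<^sub>R cis (w * t)))"
    by (simp add: integral_unique abs_Re_le_cmod)
  have "((\<lambda>t. K t * sin (w * t)) has_integral Im (integral {a..b} (\<lambda>t. K t *\<^sub>R cis (w * t)))) {a..b}"
    using has_integral_linear[OF int bounded_linear_Im] by (simp add: o_def)
  then show "\<bar>integral {a..b} (\<lambda>t. K t * sin (w * t))\<bar> \<le> norm (integral {a..b} (\<lambda>t. K t *\<^sub>R cis (w * t)))"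
    by (simp add: integral_unique abs_Im_le_cmod)
qed

section \<open>The linearised equation along the cycle\<close>

text \<open>Gronwall for the energy \<open>w\<^sup>2 + z\<^sup>2\<close>, forward and backward in time.\<close>

lemma linear_ode2_zero:
  fixes w z A B :: "real \<Rightarrow> real"
  assumes w: "\<And>t. (w has_real_derivative z t) (at t)"
    and z: "\<And>t. (z has_real_derivative A t * w t + B t * z t) (at t)"
    and A: "\<And>t. \<bar>A t\<bar> \<le> L" and B: "\<And>t. \<bar>B t\<bar> \<le> L"
    and zero: "w t0 = 0" "z t0 = 0"
  shows "w t = 0"
proof -
  define E where "E t = (w t)\<^sup>2 + (z t)\<^sup>2" for t
  \<comment> \<open>In the derivative of the energy, 1 accounts for the term 2 w z, \<open>L\<close>
    for the one with \<open>A\<close> and 2 \<open>L\<close> for the one with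
    \<open>B\<close>.\<close>
  define K where "K = 1 + 3 * L"
  define E' where "E' t = 2 * w t * z t + 2 * z t * (A t * w t + B t * z t)" for t
  have dE: "(E has_real_derivative E' t) (at t)" for t
    unfolding E_def[abs_def] E'_def
    by (auto intro!: derivative_eq_intros w z simp: algebra_simps)
  have L0: "0 \<le> L" using A[of 0] by linarith
  have E'_le: "\<bar>E' t\<bar> \<le> K * E t" for t
  proof -
    have wz: "2 * \<bar>w t * z t\<bar> \<le> E t"
      using sum_squares_bound[of "\<bar>w t\<bar>" "\<bar>z t\<bar>"] by (simp add: E_def abs_mult)
    have "\<bar>E' t\<bar> = \<bar>2 * (w t * z t) + A t * (2 * (w t * z t)) + B t * (2 * (z t)\<^sup>2)\<bar>"
      by (simp add: E'_def algebra_simps power2_eq_square)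
    also have "\<dots> \<le> \<bar>2 * (w t * z t)\<bar> + \<bar>A t * (2 * (w t * z t))\<bar> + \<bar>B t * (2 * (z t)\<^sup>2)\<bar>"
      by linarith
    also have "\<dots> \<le> E t + L * E t + L * (2 * E t)"
      unfolding abs_mult[of "A t"] abs_mult[of "B t"]
      using wz A B L0 by (intro add_mono mult_mono) (auto simp: E_def)
    finally show ?thesis by (simp add: K_def algebra_simps)
  qed
  have "E t \<le> 0"
  proof (cases "t0 \<le> t")
    case True
    have "E t * exp (- K * t) \<le> E t0 * exp (- K * t0)"
    proof (rule DERIV_nonpos_imp_nonincreasing[OF True])
      fix s
      have "((\<lambda>t. E t * exp (- K * t)) has_real_derivative (E' s - K * E s) * exp (- K * s)) (at s)"
        by (auto intro!: derivative_eq_intros dE simp: algebra_simps)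
      moreover have "(E' s - K * E s) * exp (- K * s) \<le> 0"
        using E'_le[of s] by (intro mult_nonpos_nonneg) auto
      ultimately show "\<exists>y. ((\<lambda>t. E t * exp (- K * t)) has_real_derivative y) (at s) \<and> y \<le> 0" by blast
    qed
    then show ?thesis using zero by (simp add: E_def[of t0] mult_le_0_iff)
  next
    case False
    have "E t * exp (K * t) \<le> E t0 * exp (K * t0)"
    proof (rule DERIV_nonneg_imp_nondecreasing[of t t0])
      fix s
      have "((\<lambda>t. E t * exp (K * t)) has_real_derivative (E' s + K * E s) * exp (K * s)) (at s)"
        by (auto intro!: derivative_eq_intros dE simp: algebra_simps)
      moreover have "(E' s + K * E s) * exp (K * s) \<ge> 0"
        using E'_le[of s] by (intro mult_nonneg_nonneg) auto
      ultimately show "\<exists>y. ((\<lambda>t. E t * exp (K * t)) has_real_derivative y) (at s) \<and> 0 \<le> y" by blast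
    qed (use False in simp)
    then show ?thesis using zero by (simp add: E_def[of t0] mult_le_0_iff)
  qed
  then show ?thesis by (simp add: E_def sum_power2_le_zero_iff)
qed

section \<open>Antiderivatives, periodic functions and an exponential inequality\<close>

lemma continuous_antiderivative:
  fixes g :: "real \<Rightarrow> real"
  assumes "continuous_on UNIV g"
  shows "\<exists>G. G 0 = 0 \<and> (\<forall>t. (G has_real_derivative g t) (at t))"
proof -
  have "isCont g t" for t
    using assms by (simp add: continuous_on_eq_continuous_at)
  then obtain F where F: "\<And>t. (F has_real_derivative g t) (at t)"
    using einterval_antiderivative[of "-\<infinity>" "\<infinity>" g]
    by (auto simp: has_real_derivative_iff_has_vector_derivative)
  have "((\<lambda>t. F t - F 0) has_real_derivative g t) (at t)" for t
    by (auto intro!: derivative_eq_intros F)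
  then show ?thesis by (intro exI[of _ "\<lambda>t. F t - F 0"]) auto
qed

lemma periodic_bounded:
  fixes g :: "real \<Rightarrow> 'a::real_normed_vector"
  assumes cont: "continuous_on UNIV g" and per: "\<And>t. g (t + T) = g t" and T: "T > 0"
  shows "\<exists>B>0. \<forall>t. norm (g t) \<le> B"
proof -
  interpret periodic_fun_simple g T by standard (rule per)
  have "compact (g ` {0..T})"
    by (intro compact_continuous_image continuous_on_subset[OF cont]) auto
  then obtain B where B: "B > 0" "\<And>t. t \<in> {0..T} \<Longrightarrow> norm (g t) \<le> B"
    using compact_imp_bounded[of "g ` {0..T}"] by (auto simp: bounded_pos)
  have "norm (g t) \<le> B" for t
  proof -
    define s where "s = t - of_int \<lfloor>t / T\<rfloor> * T"
    have "s \<in> {0..T}"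
      using T floor_divide_lower[OF T, of t] floor_divide_upper[OF T, of t]
      by (auto simp: s_def algebra_simps)
    moreover have "g t = g s" by (simp add: s_def minus_of_int)
    ultimately show ?thesis using B by simp
  qed
  with B(1) show ?thesis by blast
qed

lemma real_has_derivative_continuous_on:
  fixes g g' :: "real \<Rightarrow> real"
  assumes "\<And>t. (g has_real_derivative g' t) (at t)"
  shows "continuous_on S g"
  by (meson DERIV_continuous_on assms has_field_derivative_at_within)

lemma has_real_derivative_shift:
  fixes g g' :: "real \<Rightarrow> real"
  assumes "\<And>t. (g has_real_derivative g' t) (at t)"
  shows "((\<lambda>t. g (t + s)) has_real_derivative g' (t + s)) (at t)"
  using assms[of "t + s"] unfolding DERIV_shift .

text \<open>From (n - 1) (p - 1) \<ge> 0 follows n p \<ge> p + n - 1, which splits the exponential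
  into a part in p and a part in n. The latter absorbs the factor n, giving a bound uniform in
  n.\<close>

lemma exp_weight_le:
  fixes \<eta> n p c :: real
  assumes "\<eta> > 0" "n \<ge> 1" "p \<ge> 1" "c \<ge> 0"
  shows "(2 + c * (n * p)) * exp (- \<eta> * (n * p)) \<le> (2 + c) * exp \<eta> / \<eta> * p * exp (- \<eta> * p)"
proof -
  have np: "n * p \<ge> 1" using assms mult_mono[of 1 n 1 p] by simp
  have "(n - 1) * (p - 1) \<ge> 0" using assms by simp
  then have "n * p \<ge> p + n - 1" by (simp add: algebra_simps)
  then have "exp (- \<eta> * (n * p)) \<le> exp (- \<eta> * (p + n - 1))"
    using assms by (simp add: mult_left_mono)
  also have "\<dots> = exp \<eta> * exp (- \<eta> * p) * exp (- (\<eta> * n))"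
    by (simp add: exp_add[symmetric] algebra_simps)
  finally have e: "exp (- \<eta> * (n * p)) \<le> exp \<eta> * exp (- \<eta> * p) * exp (- (\<eta> * n))" .
  have "\<eta> * n \<le> exp (\<eta> * n)" using exp_ge_add_one_self[of "\<eta> * n"] by linarith
  then have en: "n * exp (- (\<eta> * n)) \<le> 1 / \<eta>"
    using assms by (simp add: exp_minus field_simps)
  have "(2 + c * (n * p)) * exp (- \<eta> * (n * p)) \<le> ((2 + c) * (n * p)) * (exp \<eta> * exp (- \<eta> * p) * exp (- (\<eta> * n)))"
    using np assms by (intro mult_mono e) (auto simp: algebra_simps)
  also have "\<dots> = (2 + c) * exp \<eta> * p * exp (- \<eta> * p) * (n * exp (- (\<eta> * n)))"
    by (simp add: ac_simps)
  also have "\<dots> \<le> (2 + c) * exp \<eta> * p * exp (- \<eta> * p) * (1 / \<eta>)"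
    using assms by (intro mult_left_mono en) auto
  finally show ?thesis by (simp add: ac_simps)
qed

lemma rescale_deriv:
  fixes g g' :: "real \<Rightarrow> real"
  assumes "\<And>t. (g has_real_derivative g' t) (at t)" "s \<noteq> 0"
  shows "((\<lambda>t. g (t / s)) has_real_derivative g' (t / s) / s) (at t)"
proof -
  have "((\<lambda>t. t / s) has_real_derivative 1 / s) (at t)"
    using assms(2) by (auto intro!: derivative_eq_intros)
  from DERIV_chain2[OF assms(1) this] show ?thesis by simp
qed

type_synonym real6 = "real \<times> real \<times> real \<times> real \<times> real \<times> real"

section \<open>The cycle and its linearisation in the original time\<close>

locale lienard_cycle =
  fixes \<alpha> \<beta> :: real and x :: "real \<Rightarrow> real" and T :: real
  assumes \<alpha>: "\<alpha> > \<beta>" and \<beta>: "\<beta> > 1"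
    and periodic: "lienard_periodic \<alpha> \<beta> x T"
    and start: "deriv x 0 = 0" "x 0 > 0"
begin

definition v :: "real \<Rightarrow> real" where "v = deriv x"
definition h :: "real \<Rightarrow> real" where "h t = h_fun \<beta> (x t)"
definition k :: "real \<Rightarrow> real" where "k t = k_fun \<alpha> \<beta> (x t)"
definition dk :: "real \<Rightarrow> real" where "dk t = \<alpha> - \<beta> + 3 * \<beta> * (x t)\<^sup>2"
definition a :: "real \<Rightarrow> real" where "a t = - (v t * h t) - k t"
text \<open>The coefficient h'(x) v + k'(x) of w in the linearised equation w'' = - Q w - h
  w'.\<close>

definition Q :: "real \<Rightarrow> real" where "Q t = 6 * \<beta> * x t * v t + dk t"
text \<open>The function F in the original time. It is taken as an antiderivative on the whole line
  because \<open>integral {0..t}\<close> vanishes for t < 0.\<close>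

definition H :: "real \<Rightarrow> real" where
  "H = (SOME G. G 0 = 0 \<and> (\<forall>t. (G has_real_derivative h t) (at t)))"

lemma T: "T > 0" using periodic by (simp add: lienard_periodic_def)

lemma x_deriv: "(x has_real_derivative v t) (at t)"
  and v_deriv: "(v has_real_derivative a t) (at t)"
  using periodic
  by (auto simp: lienard_periodic_def lienard_solution_def solves_ode2_def v_def a_def h_def k_def)

lemma h_eq: "h t = 1 - \<beta> + 3 * \<beta> * (x t)\<^sup>2" and k_eq: "k t = x t * (\<alpha> - \<beta> + \<beta> * (x t)\<^sup>2)"
  by (simp_all add: h_def k_def h_fun_def k_fun_def)

lemma h_deriv: "(h has_real_derivative 6 * \<beta> * x t * v t) (at t)"
  unfolding h_eq[abs_def] by (auto intro!: derivative_eq_intros x_deriv)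

lemma k_deriv: "(k has_real_derivative dk t * v t) (at t)"
  unfolding k_eq[abs_def] dk_def
  by (auto intro!: derivative_eq_intros x_deriv simp: algebra_simps power2_eq_square)

text \<open>Differentiating the Lienard equation along the cycle shows that the velocity
  \<open>v\<close> is itself a solution of the linearised equation.\<close>

lemma a_deriv: "(a has_real_derivative - Q t * v t - h t * a t) (at t)"
  unfolding a_def[abs_def]
  by (auto intro!: derivative_eq_intros v_deriv h_deriv k_deriv
      simp: algebra_simps Q_def a_def)

lemmas x_cont = real_has_derivative_continuous_on[OF x_deriv]
  and v_cont = real_has_derivative_continuous_on[OF v_deriv]
  and h_cont = real_has_derivative_continuous_on[OF h_deriv]
  and a_cont = real_has_derivative_continuous_on[OF a_deriv]

lemma Q_cont: "continuous_on S Q"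
  unfolding Q_def[abs_def] dk_def by (intro continuous_intros x_cont v_cont)

lemma x_per: "x (t + T) = x t"
  using periodic by (simp add: lienard_periodic_def)

lemma v_per: "v (t + T) = v t"
proof -
  have "(x has_real_derivative v (t + T)) (at t)"
    using has_real_derivative_shift[OF x_deriv, of T t] by (simp add: x_per)
  then show ?thesis using x_deriv DERIV_unique by blast
qed

lemma h_per: "h (t + T) = h t" and a_per: "a (t + T) = a t" and Q_per: "Q (t + T) = Q t"
  by (simp_all add: h_def k_def a_def Q_def dk_def x_per v_per)

lemma v_0: "v 0 = 0" and a_0: "a 0 = - k 0" and k_0: "k 0 > 0"
  using start \<alpha> \<beta> by (simp_all add: v_def a_def k_eq add_pos_nonneg)

lemma H_0: "H 0 = 0" and H_deriv: "(H has_real_derivative h t) (at t)"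
  unfolding H_def using someI_ex[OF continuous_antiderivative[OF h_cont]] by auto

lemma antiderivative_per:
  fixes G g :: "real \<Rightarrow> real"
  assumes "\<And>t. (G has_real_derivative g t) (at t)" "\<And>t. g (t + T) = g t"
  shows "G (t + T) - G t = G T - G 0"
proof -
  have "((\<lambda>t. G (t + T) - G t) has_real_derivative 0) (at t)" for t
    using DERIV_diff[OF has_real_derivative_shift[OF assms(1), of T t] assms(1)[of t]]
    by (simp add: assms(2))
  then have "G (t + T) - G t = G (0 + T) - G 0" by (intro DERIV_isconst_all) auto
  then show ?thesis by simp
qed

lemma H_shift: "H (t + T) = H t + H T"
  using antiderivative_per[OF H_deriv h_per, of t] by (simp add: H_0)

text \<open>Periodicity makes the continuous coefficients \<open>Q\<close> and \<open>h\<close>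
  bounded, as \<open>linear_ode2_zero\<close> requires.\<close>

lemma linear_unique:
  assumes w: "\<And>t. (w has_real_derivative z t) (at t)"
    and z: "\<And>t. (z has_real_derivative - Q t * w t - h t * z t) (at t)"
    and "w t0 = 0" "z t0 = 0"
  shows "w t = 0"
proof -
  obtain L1 where L1: "\<And>t. norm (Q t) \<le> L1"
    using periodic_bounded[OF Q_cont Q_per T] by blast
  obtain L2 where L2: "\<And>t. norm (h t) \<le> L2"
    using periodic_bounded[OF h_cont h_per T] by blast
  show ?thesis
  proof (rule linear_ode2_zero[where w = w and z = z and A = "\<lambda>t. - Q t" and B = "\<lambda>t. - h t" and L = "max L1 L2"])
    show "(z has_real_derivative - Q t * w t + - h t * z t) (at t)" for t
      using z[of t] by simp
    show "\<bar>- Q t\<bar> \<le> max L1 L2" "\<bar>- h t\<bar> \<le> max L1 L2" for t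
      using L1[of t] L2[of t] by auto
  qed (use assms in auto)
qed

text \<open>If \<open>v\<close> and \<open>a\<close> vanished together, uniqueness for the
  linearised equation would give \<open>v\<close> = 0 at all times, against
  \<open>a 0 = - k 0\<close>.\<close>

lemma speed_pos: "(v t)\<^sup>2 + (a t)\<^sup>2 > 0"
proof (rule ccontr)
  assume "\<not> ?thesis"
  then have "v t = 0" "a t = 0" by (auto simp: not_less sum_power2_le_zero_iff)
  then have "v s = 0" for s using linear_unique[OF v_deriv a_deriv] by blast
  then have "v = (\<lambda>_. 0)" by auto
  then have "(v has_real_derivative 0) (at 0)" by simp
  then have "a 0 = 0" using v_deriv DERIV_unique by blast
  then show False using a_0 k_0 by simp
qed

text \<open>With \<open>E\<close> the energy minus its value at \<open>(u\<^sub>1, 0)\<close>, where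
  \<open>h u\<^sub>1 = 0\<close>, the derivative of \<open>E e\<^bsup>2H\<^esup>\<close> is nonnegative because \<open>h\<close> and the potential difference
  change sign together. Over one period \<open>E e\<^bsup>2H\<^esup>\<close> is multiplied by \<open>e\<^bsup>2H(T)\<^esup>\<close>, so \<open>H(T) = 0\<close> would
  make it constant.\<close>

lemma H_T_neq_0: "H T \<noteq> 0"
proof
  assume HT: "H T = 0"
  \<comment> \<open>\<open>s\<close> is the square of u1, so \<open>h\<close> vanishes exactly where
    x^2 = s.\<close>
  define s where "s = (\<beta> - 1) / (3 * \<beta>)"
  have s: "s > 0" "3 * \<beta> * s = \<beta> - 1" using \<beta> by (auto simp: s_def)
  define E where "E t = (v t)\<^sup>2 / 2 + (\<alpha> - \<beta>) / 2 * ((x t)\<^sup>2 - s) + \<beta> / 4 * ((x t)^4 - s\<^sup>2)" for t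
  define D where "D t = 6 * \<beta> * ((x t)\<^sup>2 - s)\<^sup>2 * ((\<alpha> - \<beta>) / 2 + \<beta> / 4 * ((x t)\<^sup>2 + s))" for t
  have dE: "(E has_real_derivative - h t * (v t)\<^sup>2) (at t)" for t
    unfolding E_def[abs_def]
    by (auto intro!: derivative_eq_intros x_deriv v_deriv
        simp: a_def k_eq field_simps power2_eq_square power3_eq_cube)
  have h_s: "h t = 3 * \<beta> * ((x t)\<^sup>2 - s)" for t
    using s by (simp add: h_eq algebra_simps)
  \<comment> \<open>The kinetic energy drops out, and both \<open>h\<close> and the potential
    difference contain the factor x^2 - s, which therefore appears squared in
    \<open>D\<close>.\<close>
  have alg: "2 * h t * E t - h t * (v t)\<^sup>2 = D t" for t
    unfolding E_def D_def h_s by algebra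
  have dP: "((\<lambda>t. E t * exp (2 * H t)) has_real_derivative D t * exp (2 * H t)) (at t)" for t
    unfolding alg[symmetric]
    by (auto intro!: derivative_eq_intros dE H_deriv simp: algebra_simps)
  have D_nonneg: "D t \<ge> 0" for t
    unfolding D_def using \<alpha> \<beta> s by (intro mult_nonneg_nonneg) auto
  have mono: "E t * exp (2 * H t) \<le> E t' * exp (2 * H t')" if "t \<le> t'" for t t'
    using dP D_nonneg that by (intro DERIV_nonneg_imp_nondecreasing[OF that]) fastforce
  have "E T * exp (2 * H T) = E 0 * exp (2 * H 0)"
    using x_per[of 0] v_per[of 0] by (simp add: E_def HT H_0)
  then have const: "E t * exp (2 * H t) = E 0 * exp (2 * H 0)" if "t \<in> {0<..<T}" for t
    using mono[of 0 t] mono[of t T] that by auto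
  \<comment> \<open>Constancy makes \<open>D\<close> vanish, and its last factor is positive. With
    x^2 = s throughout, \<open>v\<close> and then \<open>a\<close> vanish inside the period, against
    \<open>speed_pos\<close>.\<close>
  have level: "(x t)\<^sup>2 = s" if t: "t \<in> {0<..<T}" for t
  proof -
    have "((\<lambda>t. E 0 * exp (2 * H 0)) has_real_derivative D t * exp (2 * H t)) (at t)"
      by (rule has_field_derivative_transform_within_open[OF dP, where S = "{0<..<T}"])
        (use t const in auto)
    then have "D t * exp (2 * H t) = 0" using DERIV_const DERIV_unique by blast
    moreover have "(\<alpha> - \<beta>) / 2 + \<beta> / 4 * ((x t)\<^sup>2 + s) > 0"
      using \<alpha> \<beta> s by (intro add_pos_nonneg) auto
    ultimately show ?thesis using \<beta> by (auto simp: D_def)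
  qed
  have v_zero: "v t = 0" if t: "t \<in> {0<..<T}" for t
  proof -
    have "((\<lambda>t. (x t)\<^sup>2) has_real_derivative 2 * x t * v t) (at t)"
      by (auto intro!: derivative_eq_intros x_deriv)
    then have "((\<lambda>t. s) has_real_derivative 2 * x t * v t) (at t)"
      by (rule has_field_derivative_transform_within_open[where S = "{0<..<T}"])
        (use t level in auto)
    then have "2 * x t * v t = 0" using DERIV_const DERIV_unique by blast
    moreover have "x t \<noteq> 0" using level[OF t] s by auto
    ultimately show ?thesis by simp
  qed
  have mid: "T / 2 \<in> {0<..<T}" using T by auto
  have "((\<lambda>t. 0) has_real_derivative a (T / 2)) (at (T / 2))"
    by (rule has_field_derivative_transform_within_open[OF v_deriv, where S = "{0<..<T}"])
      (use mid v_zero in auto)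
  then have "a (T / 2) = 0" using DERIV_const DERIV_unique by blast
  then show False using speed_pos[of "T / 2"] v_zero[OF mid] by simp
qed

text \<open>The second solution of the linearised equation is found by variation of constants in the
  moving frame spanned by \<open>(v, a)\<close> and the orthogonal vector \<open>(- a, v)\<close>; Liouville's formula gives
  the component \<open>c / N\<close> along the latter.\<close>

definition N :: "real \<Rightarrow> real" where "N t = (v t)\<^sup>2 + (a t)\<^sup>2"
definition c :: "real \<Rightarrow> real" where "c t = k 0 * exp (- H t)"
definition g :: "real \<Rightarrow> real" where
  "g t = c t / (N t)\<^sup>2 * ((1 - Q t) * ((v t)\<^sup>2 - (a t)\<^sup>2) - 2 * h t * v t * a t)"
definition A :: "real \<Rightarrow> real" where
  "A = (SOME G. G 0 = 0 \<and> (\<forall>t. (G has_real_derivative g t) (at t)))"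
definition w :: "real \<Rightarrow> real" where "w t = A t * v t - c t * a t / N t"
definition z :: "real \<Rightarrow> real" where "z t = A t * a t + c t * v t / N t"

lemma N_neq_0: "N t \<noteq> 0" unfolding N_def using speed_pos[of t] by linarith

lemma c_deriv: "(c has_real_derivative - h t * c t) (at t)"
  unfolding c_def[abs_def] by (auto intro!: derivative_eq_intros H_deriv)

lemma N_deriv: "(N has_real_derivative 2 * v t * a t * (1 - Q t) - 2 * h t * (a t)\<^sup>2) (at t)"
  unfolding N_def[abs_def]
  by (auto intro!: derivative_eq_intros v_deriv a_deriv simp: algebra_simps power2_eq_square)

lemma A_0: "A 0 = 0" and A_deriv: "(A has_real_derivative g t) (at t)"
proof -
  have "continuous_on UNIV g"
    unfolding g_def[abs_def]
    by (intro continuous_intros v_cont a_cont h_cont Q_cont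
        real_has_derivative_continuous_on[OF c_deriv] real_has_derivative_continuous_on[OF N_deriv])
      (simp add: N_neq_0)
  from someI_ex[OF continuous_antiderivative[OF this]]
  show "A 0 = 0" "(A has_real_derivative g t) (at t)" by (auto simp: A_def)
qed

text \<open>At time 0, \<open>v\<close> = 0 and \<open>a\<close> = - \<open>k 0\<close>, so the
  factor \<open>k 0\<close> in \<open>c\<close> is what normalises \<open>w\<close> to the initial
  data of \<open>w11\<close>.\<close>

lemma w_0: "w 0 = 1" and z_0: "z 0 = 0"
  using k_0 by (simp_all add: w_def z_def A_0 v_0 a_0 N_def c_def H_0 power2_eq_square)

lemma w_deriv: "(w has_real_derivative z t) (at t)"
proof -
  \<comment> \<open>Here n, p, d, y stand for \<open>N\<close>, \<open>v\<close>, \<open>a\<close>,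
    \<open>A\<close>. Keeping n as a variable lets the denominators be cleared before n = p^2 + d^2
    is used.\<close>
  have alg: "c' / n\<^sup>2 * ((1 - q) * (p\<^sup>2 - d\<^sup>2) - 2 * h' * p * d) * p + d * y -
      (((- h' * c') * d + (- q * p - h' * d) * c') * n
        - c' * d * (2 * p * d * (1 - q) - 2 * h' * d\<^sup>2)) / (n * n) = y * d + c' * p / n"
    if "n \<noteq> 0" "n = p\<^sup>2 + d\<^sup>2" for c' n q p d h' y :: real
    using that(1) by (simp add: field_simps) (use that(2) in algebra)
  show ?thesis
    unfolding w_def[abs_def] z_def
    by (rule DERIV_cong[OF DERIV_diff[OF DERIV_mult[OF A_deriv v_deriv]
          DERIV_divide[OF DERIV_mult[OF c_deriv a_deriv] N_deriv N_neq_0]]])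
      (simp only: g_def alg[OF N_neq_0 N_def])
qed

lemma z_deriv: "(z has_real_derivative - Q t * w t - h t * z t) (at t)"
proof -
  have alg: "c' / n\<^sup>2 * ((1 - q) * (p\<^sup>2 - d\<^sup>2) - 2 * h' * p * d) * d + (- q * p - h' * d) * y +
      (((- h' * c') * p + d * c') * n
        - c' * p * (2 * p * d * (1 - q) - 2 * h' * d\<^sup>2)) / (n * n) =
      - q * (y * p - c' * d / n) - h' * (y * d + c' * p / n)"
    if "n \<noteq> 0" "n = p\<^sup>2 + d\<^sup>2" for c' n q p d h' y :: real
    using that(1) by (simp add: field_simps) (use that(2) in algebra)
  show ?thesis
    unfolding w_def z_def[abs_def]
    by (rule DERIV_cong[OF DERIV_add[OF DERIV_mult[OF A_deriv a_deriv]
          DERIV_divide[OF DERIV_mult[OF c_deriv v_deriv] N_deriv N_neq_0]]])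
      (simp only: g_def alg[OF N_neq_0 N_def])
qed

text \<open>Abel's formula: the Wronskian W of two solutions satisfies W' = - h W.\<close>

lemma wronskian: "w t * a t - z t * v t = a 0 * exp (- H t)"
proof -
  have "((\<lambda>t. (w t * a t - z t * v t) * exp (H t)) has_real_derivative 0) (at t)" for t
    by (auto intro!: derivative_eq_intros w_deriv z_deriv v_deriv a_deriv H_deriv
        simp: algebra_simps)
  then have "(w t * a t - z t * v t) * exp (H t) = (w 0 * a 0 - z 0 * v 0) * exp (H 0)"
    by (intro DERIV_isconst_all) auto
  then show ?thesis by (simp add: w_0 z_0 H_0 exp_minus field_simps)
qed

text \<open>\<kappa> is chosen so that subtracting \<kappa> \<open>v\<close> from \<open>w\<close>
  leaves the Floquet solution \<open>m\<close> with multiplier \<open>exp (- H T)\<close>. The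
  division is meaningful because \<open>H T\<close> is nonzero.\<close>

definition \<kappa> :: real where "\<kappa> = z T / (a 0 * (1 - exp (- H T)))"
definition m :: "real \<Rightarrow> real" where "m t = w t - \<kappa> * v t"

text \<open>The shift of \<open>w\<close> by \<open>T\<close> solves the same equation, so it is a
  combination of \<open>w\<close> and \<open>v\<close>, read off at time 0. The coefficient of
  \<open>w\<close> is \<open>w T\<close>, which the Wronskian gives because \<open>v T\<close> =
  0.\<close>

lemma m_shift: "m (t + T) = exp (- H T) * m t"
proof -
  define n where "n = z T / a 0"
  have a0: "a 0 \<noteq> 0" using a_0 k_0 by simp
  have vT: "v T = 0" "a T = a 0" using v_per[of 0] a_per[of 0] v_0 by simp_all
  have wT: "w T = exp (- H T)" using wronskian[of T] vT a0 by simp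
  define d where "d t = w (t + T) - exp (- H T) * w t - n * v t" for t
  define e where "e t = z (t + T) - exp (- H T) * z t - n * a t" for t
  have "d t = 0"
  proof (rule linear_unique[where w = d and z = e and ?t0.0 = 0])
    show "(d has_real_derivative e t) (at t)" for t
      unfolding d_def[abs_def] e_def
      by (auto intro!: derivative_eq_intros w_deriv v_deriv has_real_derivative_shift[of w z])
    have "((\<lambda>t. z (t + T)) has_real_derivative - Q t * w (t + T) - h t * z (t + T)) (at t)" for t
      using has_real_derivative_shift[OF z_deriv, of T t] by (simp only: Q_per h_per)
    then show "(e has_real_derivative - Q t * d t - h t * e t) (at t)" for t
      unfolding d_def e_def[abs_def]
      by (auto intro!: derivative_eq_intros z_deriv a_deriv simp: algebra_simps)
    show "d 0 = 0" "e 0 = 0"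
      using a0 by (simp_all add: d_def e_def wT w_0 z_0 v_0 n_def)
  qed
  moreover have "n = \<kappa> * (1 - exp (- H T))"
    using H_T_neq_0 by (simp add: n_def \<kappa>_def)
  ultimately show ?thesis
    unfolding d_def m_def v_per by (simp add: algebra_simps)
qed

text \<open>\<open>B\<close> is the periodic solution of the adjoint equation \<open>B'' = h B' - k'(x) B\<close>.\<close>

definition B :: "real \<Rightarrow> real" where "B t = exp (H t) * m t"
definition B' :: "real \<Rightarrow> real" where "B' t = exp (H t) * (h t * m t + z t - \<kappa> * a t)"

lemma B_deriv: "(B has_real_derivative B' t) (at t)"
  unfolding B_def[abs_def] B'_def m_def
  by (auto intro!: derivative_eq_intros H_deriv w_deriv v_deriv simp: algebra_simps)

text \<open>The derivative of \<open>h\<close> cancels the term 6 \<beta> x v of \<open>Q\<close>,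
  so only \<open>dk\<close> is left.\<close>

lemma B'_deriv: "(B' has_real_derivative h t * B' t - dk t * B t) (at t)"
  unfolding B'_def[abs_def] B_def m_def
  by (auto intro!: derivative_eq_intros H_deriv w_deriv v_deriv z_deriv a_deriv h_deriv
      simp: algebra_simps Q_def)

lemma B_per: "B (t + T) = B t"
  by (simp add: B_def H_shift m_shift exp_add exp_minus)

lemma B'_per: "B' (t + T) = B' t"
proof -
  have "(B has_real_derivative B' (t + T)) (at t)"
    using has_real_derivative_shift[OF B_deriv, of T t] by (simp add: B_per)
  then show ?thesis using B_deriv DERIV_unique by blast
qed

section \<open>The resonance coefficients\<close>

definition \<sigma> :: "real \<Rightarrow> real" where "\<sigma> \<rho> = \<rho> * \<Omega>0 T"

lemma \<Omega>0_pos: "\<Omega>0 T > 0"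
  using T by (simp add: \<Omega>0_def)

lemma \<sigma>_pos: "\<rho> > 0 \<Longrightarrow> \<sigma> \<rho> > 0"
  by (simp add: \<sigma>_def \<Omega>0_pos)

lemma \<sigma>_T: "\<sigma> \<rho> * T = 2 * pi * \<rho>"
  using T by (simp add: \<sigma>_def \<Omega>0_def)

lemma period_div_\<sigma>: "\<rho> > 0 \<Longrightarrow> (t + 2 * pi * \<rho>) / \<sigma> \<rho> = t / \<sigma> \<rho> + T"
  using \<sigma>_pos[of \<rho>] \<sigma>_T[of \<rho>, symmetric] by (simp add: field_simps)

lemma u0_eq: "u0 x T \<rho> t = x (t / \<sigma> \<rho>)"
  by (simp add: u0_def \<sigma>_def)

lemma v0_eq:
  assumes "\<rho> > 0"
  shows "v0 x T \<rho> t = v (t / \<sigma> \<rho>) / \<sigma> \<rho>"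
proof -
  have "((\<lambda>t. x (t / \<sigma> \<rho>)) has_real_derivative v (t / \<sigma> \<rho>) / \<sigma> \<rho>) (at t)"
    using \<sigma>_pos[OF assms] by (intro rescale_deriv x_deriv) simp
  then show ?thesis
    unfolding v0_def u0_eq[abs_def] by (rule DERIV_imp_deriv)
qed

lemma F_fun_eq:
  assumes "\<rho> > 0"
  shows "F_fun \<beta> x T \<rho> t = H (t / \<sigma> \<rho>)"
proof -
  have s: "\<sigma> \<rho> > 0" using \<sigma>_pos[OF assms] .
  define G where "G t = \<sigma> \<rho> * H (t / \<sigma> \<rho>)" for t
  have G: "(G has_real_derivative h (t / \<sigma> \<rho>)) (at t)" for t
    unfolding G_def[abs_def] using DERIV_cmult[OF rescale_deriv[OF H_deriv], of "\<sigma> \<rho>" "\<sigma> \<rho>" t] s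
    by simp
  have int: "integral {a..b} (\<lambda>t. h (t / \<sigma> \<rho>)) = G b - G a" if "a \<le> b" for a b
    by (intro integral_unique fundamental_theorem_of_calculus[OF that])
      (use G in \<open>auto simp flip: has_real_derivative_iff_has_vector_derivative
        intro: has_field_derivative_at_within\<close>)
  have "integral {0..t} (\<lambda>t. h (t / \<sigma> \<rho>)) - integral {t..0} (\<lambda>t. h (t / \<sigma> \<rho>)) = G t - G 0"
    \<comment> \<open>For t different from 0, one of the two intervals is empty and its integral is
      0.\<close>
    by (cases t "0 :: real" rule: linorder_cases) (simp_all add: int)
  then show ?thesis
    using s by (simp add: F_fun_def u0_eq \<sigma>_def[symmetric] h_def[symmetric] G_def H_0)
qed

lemma f0_eq: "\<rho> > 0 \<Longrightarrow> f0 \<beta> x T \<rho> = H T / T / \<sigma> \<rho>"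
  unfolding f0_def by (simp add: F_fun_eq flip: \<sigma>_T)

text \<open>The definite description needs existence and uniqueness. For the latter, any candidate
  is carried back to the original time, where its difference from \<open>w\<close> has zero initial
  data.\<close>

lemma w11_eq:
  assumes "\<rho> > 0"
  shows "w11 \<alpha> \<beta> x T \<rho> = (\<lambda>t. w (t / \<sigma> \<rho>))"
proof -
  define s where "s = \<sigma> \<rho>"
  have s: "s > 0" using \<sigma>_pos[OF assms] by (simp add: s_def)
  have G: "G_fun \<alpha> \<beta> T \<rho> u y = - (y * (1 - \<beta> + 3 * \<beta> * u\<^sup>2)) / s - u * (\<alpha> - \<beta> + \<beta> * u\<^sup>2) / s\<^sup>2" for u y
    by (simp add: G_fun_def h_fun_def k_fun_def s_def \<sigma>_def power_mult_distrib)
  have Gu: "deriv (\<lambda>u. G_fun \<alpha> \<beta> T \<rho> u (v0 x T \<rho> t)) (u0 x T \<rho> t) = - Q (t / s) / s\<^sup>2" for t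
    unfolding G v0_eq[OF assms] u0_eq s_def[symmetric]
    by (rule DERIV_imp_deriv)
      (use s in \<open>auto intro!: derivative_eq_intros simp: Q_def dk_def field_simps power2_eq_square\<close>)
  have Gv: "deriv (\<lambda>y. G_fun \<alpha> \<beta> T \<rho> (u0 x T \<rho> t) y) (v0 x T \<rho> t) = - h (t / s) / s" for t
    unfolding G v0_eq[OF assms] u0_eq s_def[symmetric]
    by (rule DERIV_imp_deriv)
      (use s in \<open>auto intro!: derivative_eq_intros simp: h_eq field_simps power2_eq_square\<close>)
  show ?thesis
    unfolding w11_def Gu Gv s_def[symmetric]
  proof (rule the_equality, goal_cases)
    case 1
    have dw: "((\<lambda>t. w (t / s)) has_real_derivative z (t / s) / s) (at t)" for t
      using s by (intro rescale_deriv w_deriv) simp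
    have dz: "((\<lambda>t. z (t / s) / s) has_real_derivative
        (- Q (t / s) * w (t / s) - h (t / s) * z (t / s)) / s / s) (at t)" for t
      using s by (intro DERIV_cdivide rescale_deriv[of z "\<lambda>t. - Q t * w t - h t * z t"] z_deriv) simp
    have deriv_w: "deriv (\<lambda>t. w (t / s)) = (\<lambda>t. z (t / s) / s)"
      using DERIV_imp_deriv[OF dw] by auto
    show ?case
      unfolding solves_ode2_def deriv_w
    proof (intro conjI allI dw)
      show "((\<lambda>t. z (t / s) / s) has_real_derivative - Q (t / s) / s\<^sup>2 * w (t / s)
          + - h (t / s) / s * (z (t / s) / s)) (at t)" for t
        by (rule DERIV_cong[OF dz]) (use s in \<open>simp add: field_simps power2_eq_square\<close>)
    qed (simp_all add: w_0 z_0)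
  next
    case (2 y)
    then have y: "(y has_real_derivative deriv y t) (at t)"
      and dy: "(deriv y has_real_derivative - Q (t / s) / s\<^sup>2 * y t
          + - h (t / s) / s * deriv y t) (at t)"
      and init: "y 0 = 1" "deriv y 0 = 0" for t
      by (auto simp: solves_ode2_def)
    define d where "d t = y (s * t) - w t" for t
    define e where "e t = s * deriv y (s * t) - z t" for t
    have lin: "((\<lambda>t. s * t) has_real_derivative s) (at t)" for t
      by (auto intro!: derivative_eq_intros)
    have "d t = 0" for t
    proof (rule linear_unique[where w = d and z = e and ?t0.0 = 0])
      show "(d has_real_derivative e t) (at t)" for t
        unfolding d_def[abs_def] e_def
        by (rule DERIV_cong[OF DERIV_diff[OF DERIV_chain2[OF y lin] w_deriv]]) simp
      show "(e has_real_derivative - Q t * d t - h t * e t) (at t)" for t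
        unfolding d_def e_def[abs_def]
        by (rule DERIV_cong[OF DERIV_diff[OF DERIV_cmult[OF DERIV_chain2[OF dy lin]] z_deriv]])
          (use s in \<open>simp add: field_simps power2_eq_square\<close>)
    qed (simp_all add: d_def e_def init w_0 z_0)
    from this[of "_ / s"] show ?case using s by (auto simp: d_def)
  qed
qed

text \<open>The Floquet solution gives b = e^(f0 \<tau>) m, and multiplying by e^(F - f0 \<tau>)
  leaves e^F m, which is \<open>B\<close>.\<close>

lemma exp_F_tilde_mult_b_fun:
  assumes "\<rho> > 0"
  shows "exp (F_tilde \<beta> x T \<rho> t) * b_fun \<alpha> \<beta> x T \<rho> t = B (t / \<sigma> \<rho>)"
proof -
  define s where "s = \<sigma> \<rho>"
  have s: "s > 0" using \<sigma>_pos[OF assms] by (simp add: s_def)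
  define f where "f = H T / T"
  have f: "f \<noteq> 0" using H_T_neq_0 T by (simp add: f_def)
  have fT: "f * T = H T" using T by (simp add: f_def)
  have f0: "f0 \<beta> x T \<rho> = f / s" using f0_eq[OF assms] by (simp add: f_def s_def)
  have shift: "(t + 2 * pi * \<rho>) / s = t / s + T" for t
    using period_div_\<sigma>[OF assms] by (simp add: s_def)
  have inv: "exp (- (f / s) * t) * (exp (f * (t / s)) * y) = y" for t y
    by (simp add: mult.assoc[symmetric] exp_add[symmetric])
  have "b_fun \<alpha> \<beta> x T \<rho> = (\<lambda>t. exp (f * (t / s)) * m (t / s))"
    unfolding b_fun_def w11_eq[OF assms] v0_eq[OF assms] f0 s_def[symmetric]
  proof (rule the_equality, goal_cases)
    case 1
    have "exp (f * (t / s + T)) * m (t / s + T) = exp (f * (t / s)) * m (t / s)" for t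
      by (simp add: distrib_left exp_add fT m_shift exp_minus)
    moreover have "v (t / s + T) = v (t / s)" for t by (rule v_per)
    moreover have "w (t / s) = \<kappa> * s * (v (t / s) / s)
        + exp (- (f / s) * t) * (exp (f * (t / s)) * m (t / s))" for t
      unfolding inv using s by (simp add: m_def)
    ultimately show ?case
      unfolding shift
      by (intro conjI allI exI[of _ "\<lambda>t. \<kappa> * s * (v (t / s) / s)"] exI[of _ "\<kappa> * s"])
        (auto simp: shift)
  next
    case (2 b)
    then obtain a' where b_per: "\<And>t. b (t + 2 * pi * \<rho>) = b t"
      and a_per: "\<And>t. a' (t + 2 * pi * \<rho>) = a' t"
      and w: "\<And>t. w (t / s) = a' t + exp (- (f / s) * t) * b t"
      by blast
    define d where "d t = b t - exp (f * (t / s)) * m (t / s)" for t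
    define e where "e t = \<kappa> * v (t / s) - a' t" for t
    have ed: "e t = exp (- (f / s) * t) * d t" for t
      unfolding d_def right_diff_distrib inv using w[of t] by (simp add: e_def m_def)
    have d_per: "d (t + 2 * pi * \<rho>) = d t" for t
      by (simp add: d_def b_per shift distrib_left exp_add fT m_shift exp_minus)
    have e_per: "e (t + 2 * pi * \<rho>) = e t" for t
      by (simp add: e_def a_per shift v_per)
    \<comment> \<open>\<open>e\<close> and \<open>d\<close> are both periodic and differ by the
      factor e^(- f0 \<tau>), which changes over a period since f0 is nonzero. Hence b is
      unique.\<close>
    have "d t = 0" for t
    proof -
      have "exp (- (f / s) * (t + 2 * pi * \<rho>)) * d t = exp (- (f / s) * t) * d t"
        using e_per[of t] unfolding ed d_per .
      moreover have "- (f / s) * (t + 2 * pi * \<rho>) \<noteq> - (f / s) * t"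
        using f s assms by simp
      ultimately show ?thesis by (metis exp_inj_iff mult_cancel_right)
    qed
    then show ?case by (auto simp: d_def)
  qed
  then show ?thesis
    unfolding F_tilde_def F_fun_eq[OF assms] f0 B_def s_def[symmetric]
    by (simp add: exp_diff)
qed

section \<open>The kernels in the original time and their analyticity\<close>

definition \<kappa>1 :: "real \<Rightarrow> real" where "\<kappa>1 t = B t * v t * (3 * (x t)\<^sup>2 - 1)"
definition \<kappa>2 :: "real \<Rightarrow> real" where "\<kappa>2 t = B t * x t * ((x t)\<^sup>2 - 1)"
definition A1 :: real where "A1 = integral {0..T} (\<lambda>t. B t * (v t * h t + 2 * k t)) / T"

text \<open>The factor \<rho> \<Omega>0 in \<open>K1\<close> cancels the 1 / \<sigma> of
  \<open>v0\<close>, so \<rho> enters only through the time scale.\<close>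

lemma K1_eq: "\<rho> > 0 \<Longrightarrow> K1 \<alpha> \<beta> x T \<rho> t = \<kappa>1 (t / \<sigma> \<rho>)"
  using \<Omega>0_pos
  by (simp add: K1_def exp_F_tilde_mult_b_fun u0_eq v0_eq \<kappa>1_def) (simp add: \<sigma>_def)

lemma K2_eq: "\<rho> > 0 \<Longrightarrow> K2 \<alpha> \<beta> x T \<rho> t = \<kappa>2 (t / \<sigma> \<rho>)"
  by (simp add: K2_def exp_F_tilde_mult_b_fun u0_eq \<kappa>2_def)

text \<open>After the substitution \<tau> = \<sigma> t both terms in the bracket carry 1 / \<sigma>,
  and \<open>A1\<close> is independent of \<rho>.\<close>

lemma A_const_eq:
  assumes "\<rho> > 0"
  shows "A_const \<alpha> \<beta> x T \<rho> = A1 / \<sigma> \<rho>"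
proof -
  define s where "s = \<sigma> \<rho>"
  have s: "s > 0" using \<sigma>_pos[OF assms] by (simp add: s_def)
  have sT: "2 * pi * \<rho> = s * T" by (simp add: s_def \<sigma>_T)
  let ?g = "\<lambda>t. B t * (v t * h t + 2 * k t)"
  have "(?g has_integral T * A1) {0..T}"
    using T unfolding A1_def
    by (auto intro!: integrable_integral integrable_continuous_real continuous_intros
        v_cont h_cont real_has_derivative_continuous_on[OF k_deriv]
        real_has_derivative_continuous_on[OF B_deriv])
  from has_integral_stretch_real[OF this, of "1 / s"]
  have "((\<lambda>t. ?g (t / s)) has_integral s * (T * A1)) ((\<lambda>t. t * s) ` {0..T})"
    using s by simp
  also have "(\<lambda>t. t * s) ` {0..T} = {0..s * T}"
    using image_mult_atLeastAtMost[OF s, of 0 T] by (simp add: mult.commute[of _ s])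
  finally have I: "((\<lambda>t. ?g (t / s) * (1 / s)) has_integral s * (T * A1) * (1 / s)) {0..s * T}"
    by (rule has_integral_mult_left)
  have scale: "y * (y' / s * y1 + 2 / s * y2) = y * (y' * y1 + 2 * y2) * (1 / s)" for y y' y1 y2
    using s by (simp add: field_simps)
  have "A_const \<alpha> \<beta> x T \<rho> = 1 / (s * T) * integral {0..s * T} (\<lambda>t. ?g (t / s) * (1 / s))"
    unfolding A_const_def exp_F_tilde_mult_b_fun[OF assms] sT u0_eq v0_eq[OF assms]
      \<sigma>_def[symmetric] s_def[symmetric] h_def k_def
    by (simp only: scale)
  also have "\<dots> = 1 / (s * T) * (s * (T * A1) * (1 / s))"
    using integral_unique[OF I] by simp
  finally show ?thesis using s T by (simp add: s_def)
qed

text \<open>A bilinear form whose diagonal is the vector field of (1, x, x', x^2, B, B'). The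
  coordinate 1 raises linear terms to quadratic ones, and the coordinate x^2 lowers the cubic
  ones.\<close>

definition quad :: "real6 \<Rightarrow> real6 \<Rightarrow> real6" where
  "quad = (\<lambda>(p0, p1, p2, p3, p4, p5) (q0, q1, q2, q3, q4, q5).
     (0, p0 * q2,
      - ((1 - \<beta>) * (p0 * q2) + 3 * \<beta> * (p3 * q2)) - ((\<alpha> - \<beta>) * (p0 * q1) + \<beta> * (p1 * q3)),
      2 * (p1 * q2), p0 * q5,
      (1 - \<beta>) * (p0 * q5) + 3 * \<beta> * (p3 * q5) - ((\<alpha> - \<beta>) * (p0 * q4) + 3 * \<beta> * (p3 * q4))))"

lemma bounded_bilinear_quad: "bounded_bilinear quad"
  unfolding bilinear_conv_bounded_bilinear[symmetric] bilinear_def quad_def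
  by (auto intro!: linearI simp: algebra_simps split_beta)

lemma taylor_bounded_system:
  "\<exists>R>0. (\<exists>M. taylor_bounded x M R) \<and> (\<exists>M. taylor_bounded v M R) \<and>
     (\<exists>M. taylor_bounded (\<lambda>t. 3 * (x t)\<^sup>2 - 1) M R) \<and>
     (\<exists>M. taylor_bounded (\<lambda>t. (x t)\<^sup>2 - 1) M R) \<and> (\<exists>M. taylor_bounded B M R)"
proof -
  define y where "y t = (1 :: real, x t, v t, (x t)\<^sup>2, B t, B' t)" for t
  have ode: "(y has_vector_derivative quad (y t) (y t)) (at t)" for t
  proof -
    have "(y has_vector_derivative (0, v t, a t, 2 * x t * v t, B' t, h t * B' t - dk t * B t)) (at t)"
      unfolding y_def[abs_def]
      by (intro has_vector_derivative_Pair)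
        (auto intro!: derivative_eq_intros x_deriv v_deriv B_deriv B'_deriv
          simp flip: has_real_derivative_iff_has_vector_derivative)
    also have "(0, v t, a t, 2 * x t * v t, B' t, h t * B' t - dk t * B t) = quad (y t) (y t)"
      by (simp add: y_def quad_def a_def h_eq k_eq dk_def algebra_simps power2_eq_square)
    finally show ?thesis .
  qed
  have "continuous_on UNIV y"
    by (meson ode continuous_at_imp_continuous_on has_vector_derivative_continuous)
  moreover have "y (t + T) = y t" for t
    by (simp add: y_def x_per v_per B_per B'_per)
  ultimately obtain M where M: "M > 0" "\<And>t. norm (y t) \<le> M"
    using periodic_bounded[of y T] T by blast
  obtain R where R: "R > 0" "taylor_bounded y M R"
    using taylor_bounded_quadratic_ode[OF bounded_bilinear_quad ode M(2,1)] by blast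
  note proj = taylor_bounded_bounded_linear[OF _ R(2,1)]
  \<comment> \<open>As 1 and x^2 are coordinates, the affine factors of the kernels are linear
    images of \<open>y\<close>.\<close>
  have "\<exists>M. taylor_bounded (\<lambda>t. fst (snd (y t))) M R"
    "\<exists>M. taylor_bounded (\<lambda>t. fst (snd (snd (y t)))) M R"
    "\<exists>M. taylor_bounded (\<lambda>t. 3 * fst (snd (snd (snd (y t)))) - fst (y t)) M R"
    "\<exists>M. taylor_bounded (\<lambda>t. fst (snd (snd (snd (y t)))) - fst (y t)) M R"
    "\<exists>M. taylor_bounded (\<lambda>t. fst (snd (snd (snd (snd (y t)))))) M R"
    by (rule proj, intro bounded_linear_sub bounded_linear_mult_right[THEN bounded_linear_compose]
        bounded_linear_fst_comp bounded_linear_snd_comp bounded_linear_ident)+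
  then show ?thesis using R(1) by (auto simp: y_def)
qed

lemma taylor_bounded_kernels:
  "\<exists>R>0. \<exists>M>0. taylor_bounded \<kappa>1 M R \<and> taylor_bounded \<kappa>2 M R"
proof -
  obtain R Mx Mv M3 M1 MB where R: "R > 0" and tb: "taylor_bounded x Mx R" "taylor_bounded v Mv R"
    "taylor_bounded (\<lambda>t. 3 * (x t)\<^sup>2 - 1) M3 R" "taylor_bounded (\<lambda>t. (x t)\<^sup>2 - 1) M1 R"
    "taylor_bounded B MB R"
    using taylor_bounded_system by blast
  \<comment> \<open>Each of the two multiplications in a kernel doubles \<open>R\<close>, so the
    third factor is first lifted to 2 \<open>R\<close>.\<close>
  have lift: "taylor_bounded f M (2 * R)" if "taylor_bounded f M R" for f :: "real \<Rightarrow> real" and M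
    using that R by (intro taylor_bounded_mono[OF that]) auto
  define M where "M = max 1 (max (MB * Mv * M3) (MB * Mx * M1))"
  have "taylor_bounded \<kappa>1 (MB * Mv * M3) (2 * (2 * R))"
    unfolding \<kappa>1_def[abs_def] using R by (intro taylor_bounded_mult lift tb) auto
  then have 1: "taylor_bounded \<kappa>1 M (2 * (2 * R))"
    by (rule taylor_bounded_mono) (use R in \<open>simp_all add: M_def\<close>)
  have "taylor_bounded \<kappa>2 (MB * Mx * M1) (2 * (2 * R))"
    unfolding \<kappa>2_def[abs_def] using R by (intro taylor_bounded_mult lift tb) auto
  then have 2: "taylor_bounded \<kappa>2 M (2 * (2 * R))"
    by (rule taylor_bounded_mono) (use R in \<open>simp_all add: M_def\<close>)
  have "M > 0" by (simp add: M_def)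
  with 1 2 R show ?thesis by (intro exI[of _ "2 * (2 * R)"] conjI exI[of _ M]) auto
qed

section \<open>Bounds on the resonance coefficients and on the width\<close>

lemma kernel_cont: "continuous_on S \<kappa>1" "continuous_on S \<kappa>2"
  unfolding \<kappa>1_def[abs_def] \<kappa>2_def[abs_def]
  by (intro continuous_intros x_cont v_cont real_has_derivative_continuous_on[OF B_deriv])+

lemma kernel_per: "\<kappa>1 (t + T) = \<kappa>1 t" "\<kappa>2 (t + T) = \<kappa>2 t"
  by (simp_all add: \<kappa>1_def \<kappa>2_def B_per x_per v_per)

text \<open>In \<tau> the kernel has period 2 pi p / q. The wave of frequency \<nu> is invariant
  under this shift only if q divides \<nu> p, that is \<nu> by coprimality; otherwise the integral
  is 0. In the resonant case the rescaled ratio R / \<sigma> gives the exponent.\<close>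

lemma B_coeff_bound:
  fixes p q \<nu> :: nat
  assumes tb: "taylor_bounded \<phi> M R" "R > 0" and cont: "\<And>S. continuous_on S \<phi>"
    and per: "\<And>t. \<phi> (t + T) = \<phi> t"
    and K: "\<And>\<rho> t. \<rho> > 0 \<Longrightarrow> K \<rho> t = \<phi> (t / \<sigma> \<rho>)"
    and \<psi>: "\<psi> = sin \<or> \<psi> = cos"
    and pq: "p > 0" "q > 0" "coprime p q" and \<nu>: "\<nu> > 0"
  shows "\<bar>B_coeff \<psi> K T p q \<nu>\<bar> \<le> (if q dvd \<nu>
    then 2 * M / (\<sigma> (p / q))\<^sup>2 * exp (- (\<nu> * \<sigma> (p / q)) / (2 * R)) else 0)"
proof -
  define \<rho> where "\<rho> = real p / real q"
  define s where "s = \<sigma> \<rho>"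
  define P where "P = 2 * pi * real p"
  have \<rho>: "\<rho> > 0" using pq by (simp add: \<rho>_def)
  have s: "s > 0" using \<sigma>_pos[OF \<rho>] by (simp add: s_def)
  have P: "P > 0" using pq by (simp add: P_def)
  have q\<rho>: "real q * (2 * pi * \<rho>) = P" using pq by (simp add: P_def \<rho>_def)
  interpret periodic_fun_simple \<phi> T by standard (rule per)
  have per_\<rho>: "\<phi> ((t + 2 * pi * \<rho>) / s) = \<phi> (t / s)" for t
    using period_div_\<sigma>[OF \<rho>] by (simp add: s_def per)
  have per_P: "\<phi> ((t + P) / s) = \<phi> (t / s)" for t
  proof -
    have "(t + P) / s = t / s + real q * T"
      using \<sigma>_T[of \<rho>, folded s_def] s unfolding q\<rho>[symmetric] by (simp add: field_simps)
    then show ?thesis by (simp add: plus_of_nat)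
  qed
  have cont': "continuous_on UNIV (\<lambda>t. \<phi> (t / s))"
    using s by (intro continuous_on_compose2[OF cont[of UNIV]] continuous_intros) auto
  have cis_P: "cis (real \<nu> * P) = 1"
    using cis_multiple_2pi[of "real (\<nu> * p)"] by (simp add: P_def ac_simps)
  define J where "J = integral {0..P} (\<lambda>t. \<phi> (t / s) *\<^sub>R cis (real \<nu> * t))"
  have J: "norm J \<le> (if q dvd \<nu> then 2 * M * P * exp (- (\<nu> * s) / (2 * R)) else 0)"
  proof (cases "q dvd \<nu>")
    case True
    have "norm J \<le> 2 * M * P * exp (- real \<nu> / (2 * (R / s)))"
      unfolding J_def using tb s P \<nu> cis_P per_P
      by (intro fourier_integral_bound taylor_bounded_rescale) auto
    then show ?thesis using True by (simp add: ac_simps)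
  next
    case False
    have "cis (real \<nu> * (2 * pi * \<rho>)) \<noteq> 1"
    proof
      assume "cis (real \<nu> * (2 * pi * \<rho>)) = 1"
      then have "cos (real \<nu> * (2 * pi * \<rho>)) = 1" by (metis cis.sel(1) one_complex.sel(1))
      then obtain n :: int where "real \<nu> * (2 * pi * \<rho>) = of_int n * 2 * pi"
        using cos_one_2pi_int by blast
      then have "real \<nu> * real p = of_int n * real q"
        using pq by (simp add: \<rho>_def field_simps)
      then have "of_int (int \<nu> * int p) = (of_int (n * int q) :: real)" by simp
      then have "int \<nu> * int p = n * int q" by (simp only: of_int_eq_iff)
      then have "int q dvd int (\<nu> * p)" by simp
      then have "q dvd \<nu> * p" by (simp only: of_nat_dvd_iff)
      then show False
        using False pq by (simp add: coprime_dvd_mult_left_iff coprime_commute)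
    qed
    moreover have "2 * pi * \<rho> \<le> P"
      using q\<rho> pq \<rho> mult_right_mono[of 1 "real q" "2 * pi * \<rho>"] by simp
    ultimately have "J = 0"
      unfolding J_def using \<rho>
      by (intro fourier_integral_eq_0[where L = "2 * pi * \<rho>"] cont' per_\<rho> per_P cis_P) auto
    then show ?thesis using False by simp
  qed
  have "\<bar>integral {0..P} (\<lambda>t. \<phi> (t / s) * \<psi> (real \<nu> * t))\<bar> \<le> norm J"
    unfolding J_def using \<psi> integral_mult_cos_sin_le[OF cont', of 0 P "real \<nu>"] by blast
  moreover have "B_coeff \<psi> K T p q \<nu> = 1 / P * (integral {0..P} (\<lambda>t. \<phi> (t / s) * \<psi> (real \<nu> * t)) / s\<^sup>2)"
    using K[OF \<rho>]
    by (simp add: B_coeff_def Let_def s_def \<sigma>_def P_def power_mult_distrib flip: \<rho>_def)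
  ultimately have "\<bar>B_coeff \<psi> K T p q \<nu>\<bar> \<le> norm J / (P * s\<^sup>2)"
    using P s by (simp add: abs_mult divide_right_mono)
  also have "\<dots> \<le> (if q dvd \<nu> then 2 * M * P * exp (- (\<nu> * s) / (2 * R)) else 0) / (P * s\<^sup>2)"
    using P s by (intro divide_right_mono J) auto
  finally show ?thesis
    using P by (auto simp: s_def \<rho>_def split: if_splits)
qed

text \<open>The coefficients from \<open>K1\<close> and \<open>K2\<close> give the 2. The third
  kind, which comes from f', carries the extra factor \<nu> \<sigma>.\<close>

lemma D_bound:
  fixes p q :: nat
  assumes tb: "taylor_bounded \<kappa>1 M R" "taylor_bounded \<kappa>2 M R" "R > 0"
    and pq: "p > 0" "q > 0" "coprime p q" and \<nu>: "\<nu> > 0"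
  defines "s \<equiv> \<sigma> (p / q)"
  shows "\<bar>D1 \<alpha> \<beta> x T p q \<nu>\<bar> \<le> (if q dvd \<nu> then 2 * M / s\<^sup>2 * ((2 + \<nu> * s) * exp (- (\<nu> * s) / (2 * R))) else 0)"
    and "\<bar>D2 \<alpha> \<beta> x T p q \<nu>\<bar> \<le> (if q dvd \<nu> then 2 * M / s\<^sup>2 * ((2 + \<nu> * s) * exp (- (\<nu> * s) / (2 * R))) else 0)"
proof -
  define b where "b = (if q dvd \<nu> then 2 * M / s\<^sup>2 * exp (- (\<nu> * s) / (2 * R)) else 0)"
  have s: "s > 0" using pq unfolding s_def by (intro \<sigma>_pos) simp
  have bound1: "\<bar>B_coeff \<psi> (K1 \<alpha> \<beta> x T) T p q \<nu>\<bar> \<le> b" if "\<psi> = sin \<or> \<psi> = cos" for \<psi>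
    unfolding b_def s_def
    by (rule B_coeff_bound[OF tb(1,3) kernel_cont(1) kernel_per(1) K1_eq that pq \<nu>])
  have bound2: "\<bar>B_coeff \<psi> (K2 \<alpha> \<beta> x T) T p q \<nu>\<bar> \<le> b" if "\<psi> = sin \<or> \<psi> = cos" for \<psi>
    unfolding b_def s_def
    by (rule B_coeff_bound[OF tb(2,3) kernel_cont(2) kernel_per(2) K2_eq that pq \<nu>])
  have bounds: "\<bar>B11 \<alpha> \<beta> x T p q \<nu>\<bar> \<le> b" "\<bar>B12 \<alpha> \<beta> x T p q \<nu>\<bar> \<le> b"
    "\<bar>B21 \<alpha> \<beta> x T p q \<nu>\<bar> \<le> b" "\<bar>B22 \<alpha> \<beta> x T p q \<nu>\<bar> \<le> b"
    unfolding B11_def B12_def B21_def B22_def using bound1 bound2 by auto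
  have bounds3: "\<bar>B31 \<alpha> \<beta> x T p q \<nu>\<bar> \<le> \<nu> * s * b" "\<bar>B32 \<alpha> \<beta> x T p q \<nu>\<bar> \<le> \<nu> * s * b"
  proof -
    have "B31 \<alpha> \<beta> x T p q \<nu> = \<nu> * s * B22 \<alpha> \<beta> x T p q \<nu>"
      "B32 \<alpha> \<beta> x T p q \<nu> = - (\<nu> * s * B21 \<alpha> \<beta> x T p q \<nu>)"
      by (simp_all add: B31_def B32_def s_def \<sigma>_def)
    then show "\<bar>B31 \<alpha> \<beta> x T p q \<nu>\<bar> \<le> \<nu> * s * b" "\<bar>B32 \<alpha> \<beta> x T p q \<nu>\<bar> \<le> \<nu> * s * b"
      using bounds(3,4) s by (simp_all add: abs_mult mult_left_mono)
  qed
  have "\<bar>D1 \<alpha> \<beta> x T p q \<nu>\<bar> \<le> (2 + \<nu> * s) * b"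
    using bounds bounds3 unfolding D1_def by (simp add: distrib_right)
  then show "\<bar>D1 \<alpha> \<beta> x T p q \<nu>\<bar> \<le> (if q dvd \<nu> then 2 * M / s\<^sup>2 * ((2 + \<nu> * s) * exp (- (\<nu> * s) / (2 * R))) else 0)"
    by (simp add: b_def ac_simps split: if_splits)
  have "\<bar>D2 \<alpha> \<beta> x T p q \<nu>\<bar> \<le> (2 + \<nu> * s) * b"
    using bounds bounds3 unfolding D2_def by (simp add: distrib_right)
  then show "\<bar>D2 \<alpha> \<beta> x T p q \<nu>\<bar> \<le> (if q dvd \<nu> then 2 * M / s\<^sup>2 * ((2 + \<nu> * s) * exp (- (\<nu> * s) / (2 * R))) else 0)"
    by (simp add: b_def ac_simps split: if_splits)
qed

text \<open>Only \<nu> = q j contributes, and then \<nu> \<sigma> = \<Omega>0 j p: the decay is in p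
  with a rate free of \<rho>. The geometric decay of \<open>fhat\<close> from \<nu> = q on gives the
  factor in q.\<close>

lemma frakD1_bound:
  fixes p q :: nat and \<Phi> \<xi> \<eta> C :: real
  assumes tb: "taylor_bounded \<kappa>1 M R" "taylor_bounded \<kappa>2 M R" "R > 0" and M: "M > 0"
    and fhat: "\<And>\<nu>. \<nu> \<ge> 1 \<Longrightarrow> \<bar>fhat \<nu>\<bar> \<le> \<Phi> * exp (- \<xi> * real \<nu>)" and \<Phi>: "\<Phi> > 0" and \<xi>: "\<xi> > 0"
    and pq: "p > 0" "q > 0" "coprime p q"
  defines "\<eta> \<equiv> \<Omega>0 T / (2 * R)"
  defines "C \<equiv> (2 + \<Omega>0 T) * exp \<eta> / \<eta>"
  shows "\<bar>frakD1 \<alpha> \<beta> x T fhat p q t\<bar> \<le>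
    4 * M * \<Phi> * C / (\<bar>A1\<bar> * (1 - exp (- \<xi>))) / \<sigma> (p / q) * p * exp (- \<eta> * p) * exp (- \<xi> * q)"
proof -
  define s where "s = \<sigma> (p / q)"
  define c where "c = 4 * M * \<Phi> * C / s\<^sup>2 * p * exp (- \<eta> * p)"
  have s: "s > 0" using pq unfolding s_def by (intro \<sigma>_pos) simp
  have \<eta>: "\<eta> > 0" using \<Omega>0_pos tb by (simp add: \<eta>_def)
  have C: "C > 0" using \<Omega>0_pos \<eta> by (simp add: C_def)
  have c: "c > 0" using M \<Phi> C s pq by (simp add: c_def)
  let ?term = "\<lambda>n. fhat (Suc n) * (D1 \<alpha> \<beta> x T p q (Suc n) * cos (real (Suc n) * t) +
                             D2 \<alpha> \<beta> x T p q (Suc n) * sin (real (Suc n) * t))"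
  \<comment> \<open>The majorant allows every \<nu> = \<open>Suc n\<close> from q on, not only
    multiples of q, so that its sum is a plain geometric series.\<close>
  define G where "G n = (if q \<le> Suc n then c * exp (- \<xi> * q) * exp (- \<xi>) ^ (Suc n - q) else 0)" for n
  have term_le: "norm (?term n) \<le> G n" for n
  proof (cases "q dvd Suc n")
    case False
    have "D1 \<alpha> \<beta> x T p q (Suc n) = 0" "D2 \<alpha> \<beta> x T p q (Suc n) = 0"
      using D_bound[OF tb pq, of "Suc n"] False by auto
    then show ?thesis using c by (simp add: G_def)
  next
    case True
    define \<nu> where "\<nu> = Suc n"
    obtain j where j: "\<nu> = q * j" using True by (auto simp: \<nu>_def dvd_def)
    have j1: "j \<ge> 1" using j by (cases j) (auto simp: \<nu>_def)
    have q\<nu>: "q \<le> \<nu>" using True by (auto simp: \<nu>_def dest: dvd_imp_le)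
    define b where "b = 2 * M / s\<^sup>2 * (C * p * exp (- \<eta> * p))"
    have \<nu>s: "\<nu> * s = \<Omega>0 T * (real j * real p)"
      using pq by (simp add: j s_def \<sigma>_def)
    then have ex: "- (\<nu> * s) / (2 * R) = - \<eta> * (real j * real p)"
      by (simp add: \<eta>_def)
    have "(2 + \<nu> * s) * exp (- (\<nu> * s) / (2 * R)) \<le> C * p * exp (- \<eta> * p)"
      unfolding ex unfolding \<nu>s C_def using \<eta> j1 pq \<Omega>0_pos by (intro exp_weight_le) auto
    then have le_b: "2 * M / s\<^sup>2 * ((2 + \<nu> * s) * exp (- (\<nu> * s) / (2 * R))) \<le> b"
      unfolding b_def using M by (intro mult_left_mono) auto
    have D: "\<bar>D1 \<alpha> \<beta> x T p q \<nu>\<bar> \<le> b" "\<bar>D2 \<alpha> \<beta> x T p q \<nu>\<bar> \<le> b"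
      using D_bound[OF tb pq, of \<nu>] True le_b by (auto simp: \<nu>_def[symmetric] s_def[symmetric])
         (simp_all add: \<nu>_def)
    have b0: "0 \<le> b" using D(1) by linarith
    have "\<bar>D1 \<alpha> \<beta> x T p q \<nu> * cos (real \<nu> * t) + D2 \<alpha> \<beta> x T p q \<nu> * sin (real \<nu> * t)\<bar> \<le> b * 1 + b * 1"
      by (rule order_trans[OF abs_triangle_ineq], unfold abs_mult)
        (intro add_mono mult_mono D b0; simp)
    then have "norm (?term n) \<le> \<Phi> * exp (- \<xi> * real \<nu>) * (b * 1 + b * 1)"
      unfolding real_norm_def abs_mult \<nu>_def[symmetric] using fhat[of \<nu>] \<Phi> q\<nu> pq
      by (intro mult_mono) auto
    also have "\<dots> = c * exp (- \<xi> * real \<nu>)"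
      by (simp add: b_def c_def)
    also have "exp (- \<xi> * real \<nu>) = exp (- \<xi> * q) * exp (- \<xi>) ^ (\<nu> - q)"
      using q\<nu> by (simp add: exp_of_nat_mult[symmetric] exp_add[symmetric] of_nat_diff algebra_simps)
    finally show ?thesis using q\<nu> by (simp add: G_def \<nu>_def)
  qed
  have "(\<lambda>n. c * exp (- \<xi> * q) * exp (- \<xi>) ^ n) sums (c * exp (- \<xi> * q) * (1 / (1 - exp (- \<xi>))))"
    using \<xi> by (intro sums_mult geometric_sums) simp
  \<comment> \<open>The index is shifted by q - 1 because the frequency at index n is
    \<open>Suc n\<close>.\<close>
  also have "(\<lambda>n. c * exp (- \<xi> * q) * exp (- \<xi>) ^ n) = (\<lambda>n. G (n + (q - 1)))"
    using pq by (auto simp: G_def fun_eq_iff)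
  finally have "G sums (c * exp (- \<xi> * q) * (1 / (1 - exp (- \<xi>))))"
    by (subst (asm) sums_zero_iff_shift) (auto simp: G_def)
  then have "norm (suminf ?term) \<le> c * exp (- \<xi> * q) * (1 / (1 - exp (- \<xi>)))"
    using norm_suminf_le[of ?term G] term_le by (simp add: sums_iff)
  moreover have "frakD1 \<alpha> \<beta> x T fhat p q t = s / A1 * suminf ?term"
    using pq unfolding frakD1_def by (simp add: A_const_eq s_def)
  ultimately have "\<bar>frakD1 \<alpha> \<beta> x T fhat p q t\<bar> \<le>
      s / \<bar>A1\<bar> * (c * exp (- \<xi> * q) * (1 / (1 - exp (- \<xi>))))"
    using s by (simp only: abs_mult real_norm_def) (intro mult_mono; simp)
  also have "\<dots> = 4 * M * \<Phi> * C / (\<bar>A1\<bar> * (1 - exp (- \<xi>))) / s * p * exp (- \<eta> * p) * exp (- \<xi> * q)"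
    using s by (simp add: c_def power2_eq_square ac_simps)
  finally show ?thesis unfolding s_def .
qed

text \<open>The prefactor \<sigma>^2 against the 1 / \<sigma> in \<open>frakD1_bound\<close> leaves
  \<sigma> = \<Omega>0 p / q; with the p already present there this is p^2 / q.\<close>

lemma \<Delta>1\<omega>_bound:
  fixes \<Phi> \<xi> :: real
  assumes fhat: "\<And>\<nu>. \<nu> \<ge> 1 \<Longrightarrow> \<bar>fhat \<nu>\<bar> \<le> \<Phi> * exp (- \<xi> * real \<nu>)" and \<Phi>: "\<Phi> > 0" and \<xi>: "\<xi> > 0"
  shows "\<exists>\<xi>1>0. \<exists>C>0. \<forall>p q :: nat. p > 0 \<longrightarrow> q > 0 \<longrightarrow> coprime p q \<longrightarrow>
           \<bar>\<Delta>1\<omega> \<alpha> \<beta> x T fhat p q\<bar>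
             \<le> C * (real p)\<^sup>2 / real q * exp (- \<xi>1 * real p) * exp (- \<xi> * real q)"
proof -
  obtain R M where R: "R > 0" and M: "M > 0" and tb: "taylor_bounded \<kappa>1 M R" "taylor_bounded \<kappa>2 M R"
    using taylor_bounded_kernels by blast
  define \<eta> where "\<eta> = \<Omega>0 T / (2 * R)"
  define C0 where "C0 = 4 * M * \<Phi> * ((2 + \<Omega>0 T) * exp \<eta> / \<eta>) / (\<bar>A1\<bar> * (1 - exp (- \<xi>)))"
  \<comment> \<open>The summand 1 keeps \<open>C\<close> positive even if \<open>A1\<close> = 0,
    when \<open>C0\<close> is 0 by the convention for division.\<close>
  define C where "C = 2 * \<Omega>0 T * C0 + 1"
  have \<eta>: "\<eta> > 0" using \<Omega>0_pos R by (simp add: \<eta>_def)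
  have C0: "C0 \<ge> 0" using M \<Phi> \<xi> \<eta> \<Omega>0_pos by (simp add: C0_def)
  have C: "C > 0" using C0 \<Omega>0_pos by (simp add: C_def add_nonneg_pos)
  have "\<bar>\<Delta>1\<omega> \<alpha> \<beta> x T fhat p q\<bar>
      \<le> C * (real p)\<^sup>2 / real q * exp (- \<eta> * real p) * exp (- \<xi> * real q)"
    if pq: "p > 0" "q > 0" "coprime p q" for p q :: nat
  proof -
    define s where "s = \<sigma> (p / q)"
    define b where "b = C0 / s * p * exp (- \<eta> * p) * exp (- \<xi> * q)"
    have s: "s > 0" using pq unfolding s_def by (intro \<sigma>_pos) simp
    let ?D = "frakD1 \<alpha> \<beta> x T fhat p q"
    have D: "\<bar>?D t\<bar> \<le> b" for t
      unfolding b_def C0_def \<eta>_def s_def by (rule frakD1_bound[OF tb R M fhat \<Phi> \<xi> pq])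
    have ne: "?D ` {0..2 * pi} \<noteq> {}" by simp
    have "\<bar>SUP t\<in>{0..2 * pi}. ?D t\<bar> \<le> b" "\<bar>INF t\<in>{0..2 * pi}. ?D t\<bar> \<le> b"
      using D by (intro cSup_abs_le cInf_abs_ge ne; force)+
    then have "\<bar>(SUP t\<in>{0..2 * pi}. ?D t) - (INF t\<in>{0..2 * pi}. ?D t)\<bar> \<le> 2 * b" by linarith
    then have "\<bar>\<Delta>1\<omega> \<alpha> \<beta> x T fhat p q\<bar> \<le> s\<^sup>2 * (2 * b)"
      unfolding \<Delta>1\<omega>_def s_def \<sigma>_def power_mult_distrib by (simp add: abs_mult mult_left_mono)
    also have "\<dots> = 2 * C0 * s * p * exp (- \<eta> * p) * exp (- \<xi> * q)"
      using s by (simp add: b_def power2_eq_square)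
    also have "\<dots> = (2 * \<Omega>0 T * C0) * (real p)\<^sup>2 / real q * exp (- \<eta> * real p) * exp (- \<xi> * real q)"
      by (simp add: s_def \<sigma>_def power2_eq_square)
    also have "\<dots> \<le> C * (real p)\<^sup>2 / real q * exp (- \<eta> * real p) * exp (- \<xi> * real q)"
      by (intro mult_right_mono divide_right_mono) (auto simp: C_def)
    finally show ?thesis .
  qed
  then show ?thesis using \<eta> C by blast
qed

end

theorem mainTheorem1:
  fixes \<alpha> \<beta> \<Phi> \<xi> T0 :: real
    and x f :: "real \<Rightarrow> real"
    and fhat :: "nat \<Rightarrow> real"
  assumes "\<alpha> > \<beta>" and "\<beta> > 1"
    and "limit_cycle \<alpha> \<beta> x T0" and "deriv x 0 = 0" and "x 0 > 0"
    and "\<forall>t. f (- t) = - f t" and "real_analytic f" and "\<forall>t. f (t + 2 * pi) = f t"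
    and "\<forall>t. (\<lambda>n. fhat (Suc n) * sin (real (Suc n) * t)) sums f t"
    and "\<Phi> > 0" and "\<xi> > 0"
    and "\<forall>\<nu>\<ge>1. \<bar>fhat \<nu>\<bar> \<le> \<Phi> * exp (- \<xi> * real \<nu>)"
  shows "\<exists>\<xi>1>0. \<exists>C>0. \<forall>p q :: nat. p > 0 \<longrightarrow> q > 0 \<longrightarrow> coprime p q \<longrightarrow>
           \<bar>\<Delta>1\<omega> \<alpha> \<beta> x T0 fhat p q\<bar>
             \<le> C * (real p)\<^sup>2 / real q * exp (- \<xi>1 * real p) * exp (- \<xi> * real q)"
proof -
  interpret lienard_cycle \<alpha> \<beta> x T0
    using assms by unfold_locales (auto simp: limit_cycle_def)
  show ?thesis using assms by (intro \<Delta>1\<omega>_bound[where \<Phi> = \<Phi>]) auto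
qed

end
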